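(* Let $X\subset\mathbf{R}^n$ be a locally closed set. Suppose that the tangent cone $T_pX$ is flat for each $p\in X$, and depends continuously on $p$. Then $X$ is a union of $\mathcal{C}^1$ hypersurfaces. Further, if there is a constant $m<3/2$ such that the multiplicity of each $T_pX$, $p\in X$, is at most $m$, then $X$ is a hypersurface.
   Context: Locally closed: the intersection of a closed set with an open set of $\mathbf{R}^n$. Tangent cone: for $X\subset\mathbf{R}^n$ and $p\in X$, a ray with origin $p$ and direction $u\in\mathbf{S}^{n-1}$ is the set $\{p+tu : t\ge 0\}$; rays with origin $p$ are topologized by the distance $\|u-u'\|$ between directions. $T_pX$ is the union of all rays $\ell$ with origin $p$ for which there is a sequence $p_i\in X\smallsetminus\{p\}$ converging to $p$ such that the rays from $p$ through $p_i$ converge to $\ell$ ($T_pX=\emptyset$ if $p$ is isolated in $X$). $T_pX$ is flat if it is a hyperplane (an affine hyperplane through $p$). Continuous dependence on $p$ means that the hyperplane $T_pX$ varies continuously with $p\in X$. Hypersurface: a subset of $\mathbf{R}^n$ which (with the subspace topology) is locally homeomorphic to $\mathbf{R}^{n-1}$. It is $\mathcal{C}^1$ if it may be represented locally (after a rigid motion) as the graph of a continuously differentiable function. Multiplicity of a flat tangent cone $T_pX$: the $(n-1)$-dimensional lower density of $X$ at $p$, $$\liminf_{r\to 0}\frac{\mathcal{H}^{n-1}(X\cap B^n(p,r))}{\mathcal{H}^{n-1}(r\mathbf{B}^{n-1})},$$ where $\mathcal{H}^{n-1}$ is Hausdorff measure, $B^n(p,r)$ is the closed ball of radius $r$ about $p$,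 and $\mathbf{B}^{n-1}$ is the closed unit ball of $\mathbf{R}^{n-1}$. *)

theory Defs
  imports "HOL-Analysis.Analysis"
begin

definition loc_closed :: "'a::topological_space set \<Rightarrow> bool" where
  "loc_closed X \<longleftrightarrow> (\<exists>C U. closed C \<and> open U \<and> X = C \<inter> U)"

definition ray :: "'a::real_normed_vector \<Rightarrow> 'a \<Rightarrow> 'a set" where
  "ray p u = {p + t *\<^sub>R u | t. 0 \<le> t}"

text \<open>The ray from \<open>p\<close> through \<open>q \<noteq> p\<close> has direction \<open>sgn (q - p) = (q - p) / norm (q - p)\<close>, and
  rays from \<open>p\<close> converge iff their directions do.\<close>

definition tangent_cone :: "'a::real_normed_vector set \<Rightarrow> 'a \<Rightarrow> 'a set" where
  "tangent_cone X p =
     \<Union> {ray p u | u. norm u = 1 \<and>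
          (\<exists>s :: nat \<Rightarrow> 'a. (\<forall>i. s i \<in> X - {p}) \<and> s \<longlonglongrightarrow> p \<and> (\<lambda>i. sgn (s i - p)) \<longlonglongrightarrow> u)}"

definition hyperplane_of :: "'a::euclidean_space \<times> real \<Rightarrow> 'a set" where
  "hyperplane_of = (\<lambda>(a, b). {x. a \<bullet> x = b})"

text \<open>Unit normal and offset; every affine hyperplane arises from exactly two such pairs,
  \<open>(a, b)\<close> and \<open>(-a, -b)\<close>.\<close>

definition hyperplane_params :: "('a::euclidean_space \<times> real) set" where
  "hyperplane_params = sphere 0 1 \<times> UNIV"

definition hyperplanes :: "'a::euclidean_space set set" where
  "hyperplanes = hyperplane_of ` hyperplane_params"

text \<open>The set of affine hyperplanes carries the quotient topology of \<open>S\<^sup>n\<^sup>-\<^sup>1 \<times> \<real>\<close>.\<close>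

definition hyperplane_topology :: "'a::euclidean_space set topology" where
  "hyperplane_topology =
     topology (\<lambda>W. W \<subseteq> hyperplanes \<and>
       openin (top_of_set hyperplane_params) {c \<in> hyperplane_params. hyperplane_of c \<in> W})"

lemma openin_hyperplane_topology:
  "openin hyperplane_topology W \<longleftrightarrow> W \<subseteq> hyperplanes \<and>
     openin (top_of_set hyperplane_params) {c \<in> hyperplane_params. hyperplane_of c \<in> W}"
proof -
  let ?P = "hyperplane_params :: ('a \<times> real) set"
  let ?L = "\<lambda>W. W \<subseteq> hyperplanes \<and> openin (top_of_set ?P) {c \<in> ?P. hyperplane_of c \<in> W}"
  have "istopology ?L"
    unfolding istopology_def
  proof (rule conjI; intro allI impI)
    fix S T assume ST: "?L S" "?L T"
    have "{c \<in> ?P. hyperplane_of c \<in> S \<inter> T} =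
        {c \<in> ?P. hyperplane_of c \<in> S} \<inter> {c \<in> ?P. hyperplane_of c \<in> T}" by auto
    then show "?L (S \<inter> T)" using ST by auto
  next
    fix K assume K: "\<forall>S\<in>K. ?L S"
    have "{c \<in> ?P. hyperplane_of c \<in> \<Union>K} = (\<Union>S\<in>K. {c \<in> ?P. hyperplane_of c \<in> S})" by auto
    moreover have "openin (top_of_set ?P) (\<Union>S\<in>K. {c \<in> ?P. hyperplane_of c \<in> S})"
      using K by (intro openin_Union) auto
    ultimately show "?L (\<Union>K)" using K by auto
  qed
  then show ?thesis by (simp add: hyperplane_topology_def)
qed

lemma topspace_hyperplane_topology: "topspace hyperplane_topology = hyperplanes"
proof -
  have "{c \<in> hyperplane_params. hyperplane_of c \<in> hyperplanes} = (hyperplane_params :: ('a \<times> real) set)"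
    by (auto simp: hyperplanes_def)
  then have "openin hyperplane_topology (hyperplanes :: 'a set set)"
    by (simp add: openin_hyperplane_topology)
  then show ?thesis
    by (meson openin_hyperplane_topology openin_subset openin_topspace subset_antisym)
qed

lemma quotient_map_hyperplane_of:
  "quotient_map (top_of_set hyperplane_params) hyperplane_topology hyperplane_of"
  unfolding quotient_map_def topspace_hyperplane_topology
  by (auto simp: openin_hyperplane_topology hyperplanes_def)

definition flat_tangent_cone :: "'a::euclidean_space set \<Rightarrow> 'a \<Rightarrow> bool" where
  "flat_tangent_cone X p \<longleftrightarrow> tangent_cone X p \<in> hyperplanes \<and> p \<in> tangent_cone X p"

definition continuous_tangent_cones :: "'a::euclidean_space set \<Rightarrow> bool" where
  "continuous_tangent_cones X \<longleftrightarrow>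
     continuous_map (top_of_set X) hyperplane_topology (tangent_cone X)"

text \<open>\<open>\<real>\<^sup>n\<^sup>-\<^sup>1\<close> is realised as a coordinate hyperplane of \<open>\<real>\<^sup>n\<close>. The index type \<open>'n\<close> carries no order,
  so an arbitrary but fixed index plays the role of the last one. For \<open>n = 1\<close> this is \<open>{0}\<close>.\<close>

definition last_index :: "'n::finite" where
  "last_index = (SOME k. True)"

definition coord_hyperplane :: "(real ^ 'n) set" where
  "coord_hyperplane = {x. x $ last_index = 0}"

definition hypersurface :: "(real ^ 'n) set \<Rightarrow> bool" where
  "hypersurface S \<longleftrightarrow>
     (\<forall>p\<in>S. \<exists>U V. openin (top_of_set S) U \<and> p \<in> U \<and>
        openin (top_of_set (coord_hyperplane :: (real ^ 'n) set)) V \<and> U homeomorphic V)"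

text \<open>For \<open>V\<close> open in \<open>\<real>\<^sup>n\<^sup>-\<^sup>1\<close> the filter \<open>at x within V\<close> only sees increments inside \<open>\<real>\<^sup>n\<^sup>-\<^sup>1\<close>,
  so the derivative below is the usual one in \<open>n - 1\<close> variables, with gradient \<open>g x\<close>.\<close>

definition C1_fun_on :: "(real ^ 'n) set \<Rightarrow> (real ^ 'n \<Rightarrow> real) \<Rightarrow> bool" where
  "C1_fun_on V f \<longleftrightarrow>
     (\<exists>g :: real ^ 'n \<Rightarrow> real ^ 'n. continuous_on V g \<and>
        (\<forall>x\<in>V. g x \<in> coord_hyperplane \<and> (f has_derivative (\<lambda>h. g x \<bullet> h)) (at x within V)))"

definition graph_over :: "(real ^ 'n) set \<Rightarrow> (real ^ 'n \<Rightarrow> real) \<Rightarrow> (real ^ 'n) set" where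
  "graph_over V f = (\<lambda>x. x + axis last_index (f x)) ` V"

definition rigid_motion :: "('a::euclidean_space \<Rightarrow> 'a) \<Rightarrow> bool" where
  "rigid_motion \<Phi> \<longleftrightarrow> (\<exists>c Q. orthogonal_transformation Q \<and> \<Phi> = (\<lambda>x. c + Q x))"

definition C1_hypersurface :: "(real ^ 'n) set \<Rightarrow> bool" where
  "C1_hypersurface S \<longleftrightarrow> hypersurface S \<and>
     (\<forall>p\<in>S. \<exists>U \<Phi> V f. open U \<and> p \<in> U \<and> rigid_motion \<Phi> \<and>
        openin (top_of_set coord_hyperplane) V \<and> C1_fun_on V f \<and>
        \<Phi> ` (S \<inter> U) = graph_over V f)"

text \<open>\<open>k\<close>-dimensional Hausdorff (outer) measure, normalised to agree with Lebesgue measure in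
  \<open>\<real>\<^sup>k\<close>. The case distinction only matters for \<open>k = 0\<close>, where the empty set must not be counted.
  Boundedness is required because \<open>diameter\<close> is unspecified on unbounded sets.\<close>

definition hausdorff_content :: "nat \<Rightarrow> real \<Rightarrow> 'a::metric_space set \<Rightarrow> ennreal" where
  "hausdorff_content k \<delta> A =
     (INF C \<in> {C :: nat \<Rightarrow> 'a set. A \<subseteq> (\<Union>i. C i) \<and> (\<forall>i. bounded (C i) \<and> diameter (C i) \<le> \<delta>)}.
        \<Sum>i. if C i = {} then 0 else ennreal (unit_ball_vol (real k) * (diameter (C i) / 2) ^ k))"

definition hausdorff_measure :: "nat \<Rightarrow> 'a::metric_space set \<Rightarrow> ennreal" where
  "hausdorff_measure k A = (SUP \<delta> \<in> {0<..}. hausdorff_content k \<delta> A)"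

definition tangent_multiplicity :: "(real ^ 'n) set \<Rightarrow> real ^ 'n \<Rightarrow> ennreal" where
  "tangent_multiplicity X p =
     Liminf (at_right (0::real)) (\<lambda>r.
       hausdorff_measure (CARD('n) - 1) (X \<inter> cball p r) /
       hausdorff_measure (CARD('n) - 1) (coord_hyperplane \<inter> cball (0 :: real ^ 'n) r))"

end

theory Submission
  imports Defs
begin

text \<open>Work near a point \<open>p\<close> of \<open>X\<close>, and call the normal direction \<open>a\<close> of \<open>T\<^sub>pX\<close> vertical.  Because tangent
  cones are flat, \<open>X\<close> lies near each of its points in a thin double wedge about the tangent
  hyperplane, and because they vary continuously, all tangent hyperplanes near \<open>p\<close> are almost
  horizontal.  So in a small cylinder about \<open>p\<close> the set \<open>X\<close> is compact, does not touch the lids, and meets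
  the axis in \<open>p\<close> only (\<open>flat_cyl_exists\<close>).

  The key point is that the projection of \<open>X\<close> to the horizontal hyperplane is open
  (\<open>projection_open\<close>): a missed point would have a nearest projected point, but \<open>X\<close> has
  points in every tangent direction there, in particular some that project closer.  Consequently the
  function \<open>f\<close> giving the highest point of \<open>X\<close> over each base point is defined on a full disc and
  continuous: openness keeps it from dropping and compactness keeps it from jumping up.  A continuous graph inside
  \<open>X\<close> has the tangent hyperplanes of \<open>X\<close>, so \<open>f\<close> is differentiable with continuous gradient
  (\<open>top_sheet_exists\<close>).  Its graph is a \<open>C\<^sup>1\<close> hypersurface in \<open>X\<close> through \<open>p\<close>, and these
  graphs exhaust \<open>X\<close>.

  The lowest points of \<open>X\<close> form a second \<open>C\<^sup>1\<close> graph.  If the two graphs agree near \<open>p\<close>, then \<open>X\<close> is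
  itself a graph there.  If they disagree over some \<open>x1\<close> close to the centre, consider the largest disc about
  \<open>x1\<close> over which they disagree, and a point \<open>x0\<close> of its boundary over which they agree.  At the common
  point over \<open>x0\<close> one graph contributes density about \<open>1\<close>, and the other one contributes at least
  about \<open>1 / 2\<close> from the inside of the disc.  With slopes at most \<open>\<epsilon>\<close> this makes the multiplicity at least
  a number that tends to \<open>3 / 2\<close> as \<open>\<epsilon> \<rightarrow> 0\<close> (\<open>split_sheets_density\<close>), which contradicts a uniform bound
  \<open>m < 3 / 2\<close>.

  The density estimate rests on elementary properties of Hausdorff measure: its behaviour under
  Lipschitz maps, additivity on sets at positive distance, and that a flat disc has positive and
  finite measure.  Half of a disc is compared with the disc by symmetry.\<close>

section \<open>Hausdorff measure of images and unions\<close>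

text \<open>The contribution of one covering set to \<^const>\<open>hausdorff_content\<close>.  Empty sets
  contribute nothing even when \<open>k = 0\<close>, where \<open>0 ^ 0 = 1\<close>.\<close>

abbreviation hterm :: "nat \<Rightarrow> 'a::metric_space set \<Rightarrow> ennreal" where
  "hterm k A \<equiv> (if A = {} then 0 else ennreal (unit_ball_vol (real k) * (diameter A / 2) ^ k))"

lemma hausdorff_content_le:
  assumes "A \<subseteq> (\<Union>i. C i)" "\<And>i. bounded (C i)" "\<And>i. diameter (C i) \<le> \<delta>"
  shows "hausdorff_content k \<delta> A \<le> (\<Sum>i. hterm k (C i))"
  unfolding hausdorff_content_def using assms by (intro INF_lower) auto

lemma hausdorff_content_ge:
  assumes "\<And>C. A \<subseteq> (\<Union>i. C i) \<Longrightarrow> (\<And>i. bounded (C i)) \<Longrightarrow> (\<And>i. diameter (C i) \<le> \<delta>)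
             \<Longrightarrow> c \<le> (\<Sum>i. hterm k (C i))"
  shows "c \<le> hausdorff_content k \<delta> A"
  unfolding hausdorff_content_def using assms by (intro INF_greatest) auto

lemma hausdorff_content_antimono:
  assumes "\<delta> \<le> \<epsilon>" shows "hausdorff_content k \<epsilon> A \<le> hausdorff_content k \<delta> A"
  by (rule hausdorff_content_ge, rule hausdorff_content_le) (use assms order_trans in blast)+

lemma hausdorff_content_le_measure:
  "0 < \<delta> \<Longrightarrow> hausdorff_content k \<delta> A \<le> hausdorff_measure k A"
  unfolding hausdorff_measure_def by (intro SUP_upper) auto

lemma hausdorff_measure_le:
  "(\<And>\<delta>. 0 < \<delta> \<Longrightarrow> hausdorff_content k \<delta> A \<le> c) \<Longrightarrow> hausdorff_measure k A \<le> c"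
  unfolding hausdorff_measure_def by (intro SUP_least) auto

lemma hausdorff_measure_mono:
  assumes "A \<subseteq> B" shows "hausdorff_measure k A \<le> hausdorff_measure k B"
proof (rule hausdorff_measure_le)
  fix \<delta> :: real assume "0 < \<delta>"
  have "hausdorff_content k \<delta> A \<le> hausdorff_content k \<delta> B"
    by (rule hausdorff_content_ge, rule hausdorff_content_le) (use assms in blast)+
  then show "hausdorff_content k \<delta> A \<le> hausdorff_measure k B"
    using hausdorff_content_le_measure[OF \<open>0 < \<delta>\<close>] order_trans by blast
qed

text \<open>Images of covering sets cover the image, and their diameters grow by at most the factor \<open>L\<close>.
  This one estimate serves for projections, isometries and scalings alike.\<close>

lemma hausdorff_measure_Lipschitz_image:
  assumes L: "0 < L" and f: "\<And>x y. x \<in> A \<Longrightarrow> y \<in> A \<Longrightarrow> dist (f x) (f y) \<le> L * dist x y"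
  shows "hausdorff_measure k (f ` A) \<le> ennreal (L ^ k) * hausdorff_measure k A"
proof (rule hausdorff_measure_le)
  fix \<delta> :: real assume d: "0 < \<delta>"
  have "hausdorff_content k \<delta> (f ` A) \<le> ennreal (L ^ k) * (\<Sum>i. hterm k (C i))"
    if C: "A \<subseteq> (\<Union>i. C i)" "\<And>i. bounded (C i)" "\<And>i. diameter (C i) \<le> \<delta> / L" for C
  proof -
    let ?D = "\<lambda>i. f ` (C i \<inter> A)"
    have dist_le: "dist u v \<le> L * diameter (C i)" if uv: "u \<in> ?D i" "v \<in> ?D i" for i u v
    proof -
      obtain x y where "x \<in> C i" "x \<in> A" "y \<in> C i" "y \<in> A" and eq: "u = f x" "v = f y" using uv by auto
      then have "dist u v \<le> L * dist x y" using f by simp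
      also have "\<dots> \<le> L * diameter (C i)"
        using diameter_bounded_bound[OF C(2) \<open>x \<in> C i\<close> \<open>y \<in> C i\<close>] L by simp
      finally show ?thesis .
    qed
    have bd: "bounded (?D i)" for i
    proof (cases "?D i = {}")
      case False
      then obtain u where "u \<in> ?D i" by blast
      then show ?thesis using dist_le unfolding bounded_def by blast
    qed simp
    have diam: "diameter (?D i) \<le> L * diameter (C i)" for i
      unfolding diameter_def[of "?D i"] using dist_le[of _ i]
        diameter_ge_0[OF C(2)[of i]] L by (auto intro!: cSUP_least)
    have "hausdorff_content k \<delta> (f ` A) \<le> (\<Sum>i. hterm k (?D i))"
    proof (rule hausdorff_content_le)
      show "f ` A \<subseteq> (\<Union>i. ?D i)" using C(1) by blast
      show "diameter (?D i) \<le> \<delta>" for i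
        using diam[of i] C(3)[of i] L by (simp add: field_simps)
    qed (rule bd)
    also have "\<dots> \<le> (\<Sum>i. ennreal (L ^ k) * hterm k (C i))"
    proof (intro suminf_le)
      fix i
      have "unit_ball_vol (real k) * (diameter (?D i) / 2) ^ k
          \<le> L ^ k * (unit_ball_vol (real k) * (diameter (C i) / 2) ^ k)"
      proof -
        have "(diameter (?D i) / 2) ^ k \<le> (L * diameter (C i) / 2) ^ k"
          using diam[of i] diameter_ge_0[OF bd[of i]] by (intro power_mono) auto
        then have "unit_ball_vol (real k) * (diameter (?D i) / 2) ^ k
            \<le> unit_ball_vol (real k) * (L * diameter (C i) / 2) ^ k"
          by (intro mult_left_mono) auto
        then show ?thesis by (simp add: power_mult_distrib power_divide mult_ac)
      qed
      then show "hterm k (?D i) \<le> ennreal (L ^ k) * hterm k (C i)"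
        using L diameter_ge_0[OF C(2)[of i]]
        by (auto simp: ennreal_mult[symmetric] intro!: ennreal_leI)
    qed auto
    finally show ?thesis by simp
  qed
  then have "hausdorff_content k \<delta> (f ` A) / ennreal (L ^ k) \<le> hausdorff_content k (\<delta> / L) A"
    using L by (intro hausdorff_content_ge divide_le_posI_ennreal) (auto simp: mult.commute)
  moreover have "\<dots> \<le> hausdorff_measure k A"
    using d L by (intro hausdorff_content_le_measure) auto
  ultimately have "hausdorff_content k \<delta> (f ` A) / ennreal (L ^ k) \<le> hausdorff_measure k A"
    by (rule order_trans)
  then have "ennreal (L ^ k) * (hausdorff_content k \<delta> (f ` A) / ennreal (L ^ k))
      \<le> ennreal (L ^ k) * hausdorff_measure k A" by (rule mult_left_mono) simp
  moreover have "ennreal (L ^ k) * (hausdorff_content k \<delta> (f ` A) / ennreal (L ^ k))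
      = hausdorff_content k \<delta> (f ` A)"
    using L by (simp add: ennreal_times_divide mult_divide_eq_ennreal mult.commute[of "ennreal (L ^ k)"])
  ultimately show "hausdorff_content k \<delta> (f ` A) \<le> ennreal (L ^ k) * hausdorff_measure k A" by simp
qed

text \<open>Two countable covers are merged into one by interleaving.\<close>

lemma hausdorff_measure_Un_le:
  "hausdorff_measure k (A \<union> B) \<le> hausdorff_measure k A + hausdorff_measure k B"
proof (rule hausdorff_measure_le)
  fix \<delta> :: real assume d: "0 < \<delta>"
  have *: "hausdorff_content k \<delta> (A \<union> B) \<le> (\<Sum>i. hterm k (C i)) + (\<Sum>i. hterm k (D i))"
    if C: "A \<subseteq> (\<Union>i. C i)" "\<And>i. bounded (C i)" "\<And>i. diameter (C i) \<le> \<delta>"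
      and D: "B \<subseteq> (\<Union>i. D i)" "\<And>i. bounded (D i)" "\<And>i. diameter (D i) \<le> \<delta>" for C D
  proof -
    define E where "E n = (if even n then C (n div 2) else D (n div 2))" for n
    have EC: "C i = E (2 * i)" and ED: "D i = E (2 * i + 1)" for i by (auto simp: E_def)
    have "hausdorff_content k \<delta> (A \<union> B) \<le> (\<Sum>i. hterm k (E i))"
    proof (rule hausdorff_content_le)
      have "(\<Union>i. C i) \<subseteq> (\<Union>i. E i)" "(\<Union>i. D i) \<subseteq> (\<Union>i. E i)" using EC ED by blast+
      then show "A \<union> B \<subseteq> (\<Union>i. E i)" by (meson C(1) D(1) Un_least order_trans)
      show "bounded (E i)" "diameter (E i) \<le> \<delta>" for i
        using C(2,3) D(2,3) by (simp_all add: E_def)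
    qed
    also have "\<dots> \<le> (\<Sum>i. hterm k (C i)) + (\<Sum>i. hterm k (D i))"
      unfolding suminf_eq_SUP[of "\<lambda>i. hterm k (E i)"]
    proof (rule SUP_least)
      fix n
      have "(\<Sum>i<n. hterm k (E i)) \<le> (\<Sum>i<2*n. hterm k (E i))"
        by (intro sum_mono2) auto
      also have "\<dots> = (\<Sum>i<n. hterm k (C i)) + (\<Sum>i<n. hterm k (D i))"
        by (induction n) (auto simp: EC ED add_ac)
      also have "\<dots> \<le> (\<Sum>i. hterm k (C i)) + (\<Sum>i. hterm k (D i))"
        by (intro add_mono sum_le_suminf) auto
      finally show "(\<Sum>i<n. hterm k (E i)) \<le> (\<Sum>i. hterm k (C i)) + (\<Sum>i. hterm k (D i))" .
    qed
    finally show ?thesis .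
  qed
  have approx: "\<exists>C. S \<subseteq> (\<Union>i. C i) \<and> (\<forall>i. bounded (C i) \<and> diameter (C i) \<le> \<delta>) \<and>
      (\<Sum>i. hterm k (C i)) < c" if "hausdorff_content k \<delta> S < c" for S :: "'a set" and c
  proof -
    from that[unfolded hausdorff_content_def INF_less_iff] obtain C where
      "C \<in> {C. S \<subseteq> (\<Union>i. C i) \<and> (\<forall>i. bounded (C i) \<and> diameter (C i) \<le> \<delta>)}"
      "(\<Sum>i. hterm k (C i)) < c" by (elim bexE)
    then show ?thesis by (intro exI[of _ C]) simp
  qed
  have "hausdorff_content k \<delta> (A \<union> B) \<le> hausdorff_content k \<delta> A + hausdorff_content k \<delta> B"
  proof (rule ennreal_le_epsilon)
    fix e :: real
    assume fin: "hausdorff_content k \<delta> A + hausdorff_content k \<delta> B < top" and e: "0 < e"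
    have lt: "x < x + ennreal (e / 2)" if "x < top" for x :: ennreal
      using that e by (cases x) (auto simp: ennreal_plus[symmetric] ennreal_less_iff simp del: ennreal_plus)
    obtain C where C: "A \<subseteq> (\<Union>i. C i)" "\<And>i. bounded (C i)" "\<And>i. diameter (C i) \<le> \<delta>"
        "(\<Sum>i. hterm k (C i)) < hausdorff_content k \<delta> A + ennreal (e / 2)"
      using approx[OF lt, of A] fin by auto
    obtain D where D: "B \<subseteq> (\<Union>i. D i)" "\<And>i. bounded (D i)" "\<And>i. diameter (D i) \<le> \<delta>"
        "(\<Sum>i. hterm k (D i)) < hausdorff_content k \<delta> B + ennreal (e / 2)"
      using approx[OF lt, of B] fin by auto
    have "hausdorff_content k \<delta> (A \<union> B) \<le> (\<Sum>i. hterm k (C i)) + (\<Sum>i. hterm k (D i))"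
      using C D by (intro *)
    also have "\<dots> \<le> (hausdorff_content k \<delta> A + ennreal (e / 2)) + (hausdorff_content k \<delta> B + ennreal (e / 2))"
      using C(4) D(4) by (intro add_mono) auto
    also have "\<dots> = hausdorff_content k \<delta> A + hausdorff_content k \<delta> B + (ennreal (e / 2) + ennreal (e / 2))"
      by (simp only: add_ac)
    also have "ennreal (e / 2) + ennreal (e / 2) = ennreal e" using e by (simp add: ennreal_plus[symmetric] del: ennreal_plus)
    finally show "hausdorff_content k \<delta> (A \<union> B) \<le> hausdorff_content k \<delta> A + hausdorff_content k \<delta> B + ennreal e" .
  qed
  also have "\<dots> \<le> hausdorff_measure k A + hausdorff_measure k B"
    using d by (intro add_mono hausdorff_content_le_measure)
  finally show "hausdorff_content k \<delta> (A \<union> B) \<le> hausdorff_measure k A + hausdorff_measure k B" .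
qed

text \<open>Sets of diameter less than \<open>d\<close> cannot meet both parts, so a fine cover of the union splits
  into a cover of each part.  Disjoint compact sets, the case of interest below, are
  at positive distance.\<close>

lemma hausdorff_measure_separated:
  assumes d: "0 < d" and sep: "\<And>x y. x \<in> A \<Longrightarrow> y \<in> B \<Longrightarrow> d \<le> dist x y"
  shows "hausdorff_measure k A + hausdorff_measure k B \<le> hausdorff_measure k (A \<union> B)"
proof -
  have small: "hausdorff_content k \<delta> A + hausdorff_content k \<delta> B \<le> hausdorff_content k \<delta> (A \<union> B)"
    if "\<delta> < d" for \<delta>
  proof (rule hausdorff_content_ge)
    fix C :: "nat \<Rightarrow> 'a set"
    assume C: "A \<union> B \<subseteq> (\<Union>i. C i)" "\<And>i. bounded (C i)" "\<And>i. diameter (C i) \<le> \<delta>"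
    define D where "D S i = (if C i \<inter> S = {} then {} else C i)" for S i
    have le: "hausdorff_content k \<delta> S \<le> (\<Sum>i. hterm k (D S i))" if "S \<subseteq> A \<union> B" for S
    proof (rule hausdorff_content_le)
      show "S \<subseteq> (\<Union>i. D S i)" using C(1) that unfolding D_def by fastforce
      show "bounded (D S i)" for i using C(2) by (simp add: D_def)
      show "diameter (D S i) \<le> \<delta>" for i
        using C(3)[of i] diameter_ge_0[OF C(2)[of i]] by (simp add: D_def)
    qed
    have "hausdorff_content k \<delta> A + hausdorff_content k \<delta> B
        \<le> (\<Sum>i. hterm k (D A i)) + (\<Sum>i. hterm k (D B i))" by (intro add_mono le) auto
    also have "\<dots> = (\<Sum>i. hterm k (D A i) + hterm k (D B i))" by (rule suminf_add) auto
    also have "\<dots> \<le> (\<Sum>i. hterm k (C i))"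
    proof (intro suminf_le)
      fix i
      have "C i \<inter> A = {} \<or> C i \<inter> B = {}"
      proof (rule ccontr)
        assume "\<not> ?thesis"
        then obtain x y where "x \<in> C i" "x \<in> A" "y \<in> C i" "y \<in> B" by blast
        then show False
          using diameter_bounded_bound[OF C(2), of x i y] sep[of x y] C(3)[of i] that by linarith
      qed
      then show "hterm k (D A i) + hterm k (D B i) \<le> hterm k (C i)" by (auto simp: D_def)
    qed auto
    finally show "hausdorff_content k \<delta> A + hausdorff_content k \<delta> B \<le> (\<Sum>i. hterm k (C i))" .
  qed
  have *: "hausdorff_content k \<delta> A + hausdorff_content k \<delta>' B \<le> hausdorff_measure k (A \<union> B)"
    if "0 < \<delta>" "0 < \<delta>'" for \<delta> \<delta>'
  proof -
    define \<eta> where "\<eta> = min (min \<delta> \<delta>') (d / 2)"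
    have \<eta>: "0 < \<eta>" "\<eta> \<le> \<delta>" "\<eta> \<le> \<delta>'" "\<eta> < d" using that d by (auto simp: \<eta>_def)
    have "hausdorff_content k \<delta> A + hausdorff_content k \<delta>' B
        \<le> hausdorff_content k \<eta> A + hausdorff_content k \<eta> B"
      using \<eta> by (intro add_mono hausdorff_content_antimono)
    also have "\<dots> \<le> hausdorff_content k \<eta> (A \<union> B)" using \<eta> by (intro small)
    also have "\<dots> \<le> hausdorff_measure k (A \<union> B)" using \<eta> by (intro hausdorff_content_le_measure)
    finally show ?thesis .
  qed
  have "hausdorff_content k \<delta> A + hausdorff_measure k B \<le> hausdorff_measure k (A \<union> B)" if "0 < \<delta>" for \<delta>
    unfolding hausdorff_measure_def[of k B] using *[OF that]
    by (subst ennreal_SUP_add_right) (auto intro!: SUP_least)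
  then show ?thesis
    unfolding hausdorff_measure_def[of k A]
    by (subst ennreal_SUP_add_left[symmetric]) (auto intro!: SUP_least)
qed

section \<open>Measure of flat discs and density of two sheets\<close>

lemma hausdorff_content_le_finite:
  assumes I: "finite I" and cov: "A \<subseteq> (\<Union>i\<in>I. C i)"
    and C: "\<And>i. i \<in> I \<Longrightarrow> bounded (C i)" "\<And>i. i \<in> I \<Longrightarrow> diameter (C i) \<le> \<delta>" and d: "0 \<le> \<delta>"
  shows "hausdorff_content k \<delta> A \<le> (\<Sum>i\<in>I. hterm k (C i))"
proof -
  obtain h where h: "bij_betw h {..<card I} I"
    using ex_bij_betw_nat_finite[OF I] by (auto simp: lessThan_atLeast0)
  define D where "D j = (if j < card I then C (h j) else {})" for j
  have hI: "h j \<in> I" if "j < card I" for j using h that by (auto simp: bij_betw_def)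
  have "hausdorff_content k \<delta> A \<le> (\<Sum>j. hterm k (D j))"
  proof (rule hausdorff_content_le)
    show "A \<subseteq> (\<Union>j. D j)"
    proof
      fix x assume "x \<in> A"
      then obtain i where i: "i \<in> I" "x \<in> C i" using cov by auto
      then have "i \<in> h ` {..<card I}" using h by (simp add: bij_betw_def)
      then obtain j where "j < card I" "h j = i" by auto
      then show "x \<in> (\<Union>j. D j)" using i by (auto simp: D_def intro!: exI[of _ j])
    qed
    show "bounded (D j)" "diameter (D j) \<le> \<delta>" for j using C hI d by (simp_all add: D_def)
  qed
  also have "\<dots> = (\<Sum>j<card I. hterm k (D j))"
    by (intro suminf_finite) (auto simp: D_def)
  also have "\<dots> = (\<Sum>j<card I. hterm k (C (h j)))" by (intro sum.cong) (auto simp: D_def)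
  also have "\<dots> = (\<Sum>i\<in>I. hterm k (C i))" by (rule sum.reindex_bij_betw[OF h])
  finally show ?thesis .
qed

lemma prod_if_one_index:
  fixes c :: "'b::comm_monoid_mult"
  shows "(\<Prod>j\<in>(UNIV :: 'n::finite set). if j = i then 1 else c) = c ^ (CARD('n) - 1)"
proof -
  have "(\<Prod>j\<in>(UNIV :: 'n set). if j = i then 1 else c) = (\<Prod>j\<in>UNIV - {i}. c)"
    by (subst prod.remove[of _ i]) (auto intro!: prod.cong)
  then show ?thesis by (simp add: card_Diff_singleton)
qed

text \<open>Densities are ratios to the measure of a flat disc, so that measure has to be positive and
  finite.  For finiteness, a grid of mesh \<open>2 / N\<close> covers the disc by \<open>N ^ (n - 1)\<close> cubes of diameter at
  most \<open>2 n / N\<close>, and the resulting sum is independent of \<open>N\<close>.\<close>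

lemma hausdorff_measure_disc_finite:
  "hausdorff_measure (CARD('n) - 1) (coord_hyperplane \<inter> cball (0 :: real ^ 'n) 1) < top"
proof -
  define k where "k = CARD('n) - 1"
  note prod_one = prod_if_one_index[where 'n = 'n, folded k_def]
  let ?l = "last_index :: 'n" and ?n = "real CARD('n)"
  let ?B = "coord_hyperplane \<inter> cball (0 :: real ^ 'n) 1"
  let ?M = "ennreal (unit_ball_vol (real k) * ?n ^ k)"
  have "hausdorff_content k \<delta> ?B \<le> ?M" if d: "0 < \<delta>" for \<delta>
  proof -
    obtain N :: nat where N: "2 * ?n / \<delta> < N" "0 < N"
      using reals_Archimedean2[of "2 * ?n / \<delta>"] d
      by (metis divide_nonneg_pos mult_nonneg_nonneg not_gr_zero not_le of_nat_0 of_nat_0_le_iff zero_le_numeral)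
    define I where "I = PiE (UNIV :: 'n set) (\<lambda>j. if j = ?l then {0} else {..<N})"
    define C :: "('n \<Rightarrow> nat) \<Rightarrow> (real ^ 'n) set" where "C z = {x. x $ ?l = 0 \<and>
        (\<forall>j. j \<noteq> ?l \<longrightarrow> -1 + 2 * z j / N \<le> x $ j \<and> x $ j \<le> -1 + 2 * (real (z j) + 1) / N)}" for z
    have "finite I" unfolding I_def by (intro finite_PiE) auto
    moreover have "card I = (\<Prod>j\<in>(UNIV :: 'n set). if j = ?l then 1 else N)"
      unfolding I_def by (simp add: card_PiE) (auto intro!: prod.cong)
    ultimately have I: "finite I" "card I = N ^ k" by (simp_all add: prod_one)
    have diff: "norm (x - y) \<le> 2 * ?n / N" if "x \<in> C z" "y \<in> C z" for x y z
    proof -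
      have "norm (x - y) \<le> (\<Sum>j\<in>UNIV. \<bar>(x - y) $ j\<bar>)" by (rule norm_le_l1_cart)
      also have "\<dots> \<le> (\<Sum>j\<in>(UNIV :: 'n set). 2 / N)"
      proof (rule sum_mono)
        fix j show "\<bar>(x - y) $ j\<bar> \<le> 2 / N"
        proof (cases "j = ?l")
          case False
          then have *: "-1 + 2 * real (z j) / N \<le> w $ j \<and> w $ j \<le> -1 + 2 * (real (z j) + 1) / N"
            if "w \<in> C z" for w using that by (simp add: C_def)
          have "-1 + 2 * z j / N \<le> x $ j" "x $ j \<le> -1 + 2 * (real (z j) + 1) / N"
            "-1 + 2 * z j / N \<le> y $ j" "y $ j \<le> -1 + 2 * (real (z j) + 1) / N"
            using *[OF that(1)] *[OF that(2)] by auto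
          moreover have "2 * (real (z j) + 1) / N = 2 * real (z j) / N + 2 / N"
            by (simp add: add_divide_distrib distrib_left)
          ultimately show ?thesis unfolding vector_minus_component by linarith
        qed (use that in \<open>auto simp: C_def\<close>)
      qed
      also have "\<dots> = 2 * ?n / N" by simp
      finally show ?thesis .
    qed
    have bd: "bounded (C z)" for z
      using diff unfolding bounded_def dist_norm by (cases "C z = {}") blast+
    have diam: "diameter (C z) \<le> 2 * ?n / N" for z
      unfolding diameter_def using diff[of _ z] by (auto simp: dist_norm intro!: cSUP_least)
    have "hausdorff_content k \<delta> ?B \<le> (\<Sum>z\<in>I. hterm k (C z))"
    proof (rule hausdorff_content_le_finite[OF I(1) _ bd])
      show "diameter (C z) \<le> \<delta>" for z
      proof -
        have "2 * ?n / N \<le> \<delta>" using N d by (simp add: field_simps)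
        then show ?thesis using diam[of z] by linarith
      qed
      show "?B \<subseteq> (\<Union>z\<in>I. C z)"
      proof
        fix x assume "x \<in> ?B"
        then have x0: "x $ ?l = 0" and x1: "norm x \<le> 1" by (auto simp: coord_hyperplane_def)
        have "\<exists>i<N. -1 + 2 * real i / N \<le> x $ j \<and> x $ j \<le> -1 + 2 * (real i + 1) / N" for j
        proof -
          have xj: "-1 \<le> x $ j" "x $ j \<le> 1" using component_le_norm_cart[of x j] x1 by (auto simp: abs_le_iff)
          show ?thesis
          proof (cases "x $ j = 1")
            \<comment> \<open>the right end point belongs to the last cell, where rounding down would give \<open>N\<close>\<close>
            case True
            then show ?thesis using N(2) by (intro exI[of _ "N - 1"]) (auto simp: of_nat_diff field_simps)
          next
            case False
            define t where "t = (x $ j + 1) * N / 2"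
            have t: "0 \<le> t" "t < N" using xj False N(2) by (auto simp: t_def)
            define i where "i = nat \<lfloor>t\<rfloor>"
            have "real i \<le> t" "t < real i + 1" using t by (auto simp: i_def)
            then have "real i < N" using t by linarith
            then have "i < N" by simp
            moreover have "2 * i / N \<le> x $ j + 1" "x $ j + 1 \<le> 2 * (i + 1) / N"
              using \<open>real i \<le> t\<close> \<open>t < real i + 1\<close> N(2) by (auto simp: t_def field_simps)
            ultimately show ?thesis by (intro exI[of _ i]) (auto simp: add.commute)
          qed
        qed
        then obtain z where z: "\<And>j. z j < N" "\<And>j. -1 + 2 * real (z j) / N \<le> x $ j"
          "\<And>j. x $ j \<le> -1 + 2 * (real (z j) + 1) / N" by metis
        define z' where "z' j = (if j = ?l then 0 else z j)" for j
        have "z' \<in> I" using z(1) by (auto simp: I_def z'_def)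
        moreover have "x \<in> C z'" using z x0 by (auto simp: C_def z'_def)
        ultimately show "x \<in> (\<Union>z\<in>I. C z)" by blast
      qed
    qed (use d in auto)
    also have "\<dots> \<le> (\<Sum>z\<in>I. ennreal (unit_ball_vol (real k) * (?n / N) ^ k))"
    proof (rule sum_mono)
      fix z
      have "2 * ?n / N = ?n / N * 2" by simp
      then have "diameter (C z) / 2 \<le> ?n / N" "0 \<le> diameter (C z)"
        using diam[of z] diameter_ge_0[OF bd[of z]] by linarith+
      then show "hterm k (C z) \<le> ennreal (unit_ball_vol (real k) * (?n / N) ^ k)"
        by (simp only: if_P if_not_P split: if_split) (intro impI conjI zero_le ennreal_leI mult_left_mono power_mono; simp)
    qed
    also have "\<dots> = ennreal (N ^ k * (unit_ball_vol (real k) * (?n / N) ^ k))"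
      by (simp add: I(2) ennreal_mult ennreal_of_nat_eq_real_of_nat)
    also have "N ^ k * (unit_ball_vol (real k) * (?n / N) ^ k) = unit_ball_vol (real k) * ?n ^ k"
      using N(2) by (simp add: power_divide)
    finally show ?thesis .
  qed
  then have "hausdorff_measure k ?B \<le> ?M" by (rule hausdorff_measure_le)
  also have "\<dots> < top" by simp
  finally show ?thesis by (simp only: k_def)
qed

text \<open>Positivity is reduced to Lebesgue measure in \<open>\<real>\<^sup>n\<close> by thickening along the last
  coordinate: a covering set \<open>C\<close> of diameter \<open>d\<close> is replaced by a box with side \<open>2 d\<close> in the first
  \<open>n - 1\<close> directions and \<open>1\<close> in the last one.  The boxes cover a fixed box \<open>Q\<close>, and the volume of each
  is a fixed multiple of the contribution of \<open>C\<close>.\<close>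

lemma hausdorff_measure_disc_pos:
  "0 < hausdorff_measure (CARD('n) - 1) (coord_hyperplane \<inter> cball (0 :: real ^ 'n) 1)"
proof -
  define k where "k = CARD('n) - 1"
  note prod_one = prod_if_one_index[where 'n = 'n, folded k_def]
  let ?l = "last_index :: 'n" and ?n = "real CARD('n)"
  let ?B = "coord_hyperplane \<inter> cball (0 :: real ^ 'n) 1"
  let ?\<alpha> = "unit_ball_vol (real k)"
  have \<alpha>: "0 < ?\<alpha>" by simp
  then have \<alpha>0: "?\<alpha> \<noteq> 0" by (rule less_imp_neq[symmetric])
  have cancel: "x / y * (y * z) = x * z" if "y \<noteq> 0" for x y z :: real using that by simp
  have box: "emeasure lborel (cbox x y) = ennreal (\<Prod>j\<in>UNIV. y $ j - x $ j)"
    if "\<And>j. x $ j \<le> y $ j" for x y :: "real ^ 'n"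
  proof -
    have "cbox x y \<noteq> {}" using that by (simp add: interval_ne_empty_cart)
    then show ?thesis using emeasure_lborel_cbox_finite[of x y]
      by (simp add: content_cbox_cart emeasure_eq_ennreal_measure[symmetric] emeasure_eq_ennreal_measure)
  qed
  define Q :: "(real ^ 'n) set" where
    "Q = cbox (\<chi> j. if j = ?l then 0 else - 1 / ?n) (\<chi> j. if j = ?l then 1 else 1 / ?n)"
  have mQ: "emeasure lborel Q = ennreal ((2 / ?n) ^ k)"
  proof -
    have "emeasure lborel Q = ennreal (\<Prod>j\<in>(UNIV :: 'n set). if j = ?l then 1 else 2 / ?n)"
      unfolding Q_def by (subst box) (auto intro!: arg_cong[where f = ennreal] prod.cong)
    then show ?thesis by (simp add: prod_one)
  qed
  have "ennreal ((2 / ?n) ^ k) / ennreal (4 ^ k / ?\<alpha>) \<le> hausdorff_content k 1 ?B"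
  proof (rule hausdorff_content_ge)
    fix C :: "nat \<Rightarrow> (real ^ 'n) set"
    assume C: "?B \<subseteq> (\<Union>i. C i)" "\<And>i. bounded (C i)" "\<And>i. diameter (C i) \<le> 1"
    define c where "c i = (SOME x. x \<in> C i)" for i
    have c: "c i \<in> C i" if "C i \<noteq> {}" for i using that unfolding c_def by (simp add: some_in_eq)
    define D where "D i = (if C i = {} then {} else
      cbox (\<chi> j. if j = ?l then 0 else c i $ j - diameter (C i)) (\<chi> j. if j = ?l then 1 else c i $ j + diameter (C i)))" for i
    have mD: "emeasure lborel (D i) \<le> ennreal (4 ^ k / ?\<alpha>) * hterm k (C i)" for i
    proof (cases "C i = {}")
      case False
      have d0: "0 \<le> diameter (C i)" by (rule diameter_ge_0[OF C(2)])
      have "emeasure lborel (D i) = ennreal (\<Prod>j\<in>(UNIV :: 'n set). if j = ?l then 1 else 2 * diameter (C i))"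
        unfolding D_def using False d0
        by (simp, subst box) (auto intro!: arg_cong[where f = ennreal] prod.cong split: if_splits)
      also have "\<dots> = ennreal ((2 * diameter (C i)) ^ k)" by (simp add: prod_one)
      also have "(2 * diameter (C i)) ^ k = (4 ^ k / ?\<alpha>) * (?\<alpha> * (diameter (C i) / 2) ^ k)"
      proof -
        have "(2 * diameter (C i)) ^ k = (4 * (diameter (C i) / 2)) ^ k" by simp
        also have "\<dots> = 4 ^ k * (diameter (C i) / 2) ^ k" by (rule power_mult_distrib)
        also have "\<dots> = (4 ^ k / ?\<alpha>) * (?\<alpha> * (diameter (C i) / 2) ^ k)"
          using \<alpha>0 by (subst cancel) auto
        finally show ?thesis .
      qed
      also have "ennreal ((4 ^ k / ?\<alpha>) * (?\<alpha> * (diameter (C i) / 2) ^ k))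
          = ennreal (4 ^ k / ?\<alpha>) * ennreal (?\<alpha> * (diameter (C i) / 2) ^ k)"
        using d0 \<alpha> by (intro ennreal_mult) auto
      finally show ?thesis using False by simp
    qed (simp add: D_def)
    have "Q \<subseteq> (\<Union>i. D i)"
    proof
      fix x assume x: "x \<in> Q"
      have xQ: "(if j = ?l then 0 else - 1 / ?n) \<le> x $ j" "x $ j \<le> (if j = ?l then 1 else 1 / ?n)" for j
        using x by (simp_all add: Q_def mem_box_cart)
      have xj: "\<bar>x $ j\<bar> \<le> 1 / ?n" if "j \<noteq> ?l" for j
        using xQ[of j] that by (simp add: abs_le_iff)
      define y :: "real ^ 'n" where "y = (\<chi> j. if j = ?l then 0 else x $ j)"
      have "norm y \<le> (\<Sum>j\<in>UNIV. \<bar>y $ j\<bar>)" by (rule norm_le_l1_cart)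
      also have "\<dots> \<le> (\<Sum>j\<in>(UNIV :: 'n set). 1 / ?n)" by (intro sum_mono) (simp add: y_def xj)
      finally have "y \<in> ?B" by (simp add: coord_hyperplane_def y_def)
      then obtain i where i: "y \<in> C i" using C(1) by blast
      then have ne: "C i \<noteq> {}" by blast
      have yc: "\<bar>y $ j - c i $ j\<bar> \<le> diameter (C i)" for j
        using component_le_norm_cart[of "y - c i" j] diameter_bounded_bound[OF C(2) i c[OF ne]]
        by (simp add: dist_norm)
      have "c i $ j - diameter (C i) \<le> x $ j \<and> x $ j \<le> c i $ j + diameter (C i)" if "j \<noteq> ?l" for j
      proof -
        have "y $ j = x $ j" using that by (simp add: y_def)
        then show ?thesis using yc[of j] by linarith
      qed
      moreover have "0 \<le> x $ ?l \<and> x $ ?l \<le> 1" using xQ[of ?l] by simp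
      ultimately have "x \<in> D i" using ne by (simp add: D_def mem_box_cart)
      then show "x \<in> (\<Union>i. D i)" by blast
    qed
    then have "emeasure lborel Q \<le> emeasure lborel (\<Union>i. D i)"
      by (intro emeasure_mono) (auto simp: D_def)
    also have "\<dots> \<le> (\<Sum>i. emeasure lborel (D i))"
      by (intro emeasure_subadditive_countably) (auto simp: D_def)
    also have "\<dots> \<le> (\<Sum>i. ennreal (4 ^ k / ?\<alpha>) * hterm k (C i))"
      by (intro suminf_le mD) auto
    also have "\<dots> = ennreal (4 ^ k / ?\<alpha>) * (\<Sum>i. hterm k (C i))" by simp
    finally show "ennreal ((2 / ?n) ^ k) / ennreal (4 ^ k / ?\<alpha>) \<le> (\<Sum>i. hterm k (C i))"
      using \<alpha> mQ by (intro divide_le_posI_ennreal) (auto simp: mult.commute)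
  qed
  also have "\<dots> \<le> hausdorff_measure k ?B" by (rule hausdorff_content_le_measure) simp
  finally have "ennreal ((2 / ?n) ^ k / (4 ^ k / ?\<alpha>)) \<le> hausdorff_measure k ?B"
    using \<alpha> by (subst (asm) divide_ennreal) auto
  moreover have "0 < ennreal ((2 / ?n) ^ k / (4 ^ k / ?\<alpha>))" using \<alpha> by simp
  ultimately have "0 < hausdorff_measure k ?B" by (rule less_le_trans[rotated])
  then show ?thesis by (simp only: k_def)
qed

lemma ennreal_inverse_antimono: "(x :: ennreal) \<le> y \<Longrightarrow> inverse y \<le> inverse x"
  unfolding less_eq_ennreal.rep_eq inverse_ennreal.rep_eq by (intro ereal_inverse_antimono) auto

text \<open>A half disc in direction \<open>v\<close>, without a strip of width \<open>\<delta>\<close> along its flat side.\<close>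

definition cap :: "real ^ 'n \<Rightarrow> real \<Rightarrow> (real ^ 'n) set" where
  "cap v \<delta> = {w \<in> coord_hyperplane \<inter> cball 0 1. \<delta> \<le> v \<bullet> w}"

text \<open>A half disc and its mirror image cover the disc, so it has at least half the measure; and
  \<open>w \<mapsto> (1 - \<delta>) w + \<delta> v\<close> maps the half disc into the cap.\<close>

lemma hausdorff_measure_cap_ge:
  fixes v :: "real ^ 'n"
  assumes \<delta>: "0 < \<delta>" "\<delta> < 1" and v: "v \<in> coord_hyperplane" "norm v = 1"
  shows "ennreal ((1 - \<delta>) ^ k / 2) * hausdorff_measure k (coord_hyperplane \<inter> cball (0 :: real ^ 'n) 1)
           \<le> hausdorff_measure k (cap v \<delta>)"
proof -
  let ?B = "coord_hyperplane \<inter> cball (0 :: real ^ 'n) 1"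
  let ?H = "hausdorff_measure k :: (real ^ 'n) set \<Rightarrow> ennreal"
  have neg: "uminus ` cap v 0 = {w \<in> ?B. v \<bullet> w \<le> 0}"
  proof (intro equalityI subsetI)
    fix w assume "w \<in> {w \<in> ?B. v \<bullet> w \<le> 0}"
    then have "- w \<in> cap v 0" by (auto simp: cap_def coord_hyperplane_def)
    then show "w \<in> uminus ` cap v 0" by force
  qed (auto simp: cap_def coord_hyperplane_def)
  have "?H ?B \<le> ?H (cap v 0 \<union> uminus ` cap v 0)"
    unfolding neg by (intro hausdorff_measure_mono) (auto simp: cap_def)
  also have "\<dots> \<le> ?H (cap v 0) + ?H (uminus ` cap v 0)" by (rule hausdorff_measure_Un_le)
  also have "?H (uminus ` cap v 0) \<le> ennreal (1 ^ k) * ?H (cap v 0)"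
    by (intro hausdorff_measure_Lipschitz_image) (auto simp: dist_minus)
  finally have "?H ?B \<le> 2 * ?H (cap v 0)" by (simp add: mult_2 add_left_mono)
  also have "?H (cap v 0) \<le> ?H ((\<lambda>w. (1 / (1 - \<delta>)) *\<^sub>R (w - \<delta> *\<^sub>R v)) ` cap v \<delta>)"
  proof (intro hausdorff_measure_mono subsetI)
    fix w assume w: "w \<in> cap v 0"
    define w' where "w' = (1 - \<delta>) *\<^sub>R w + \<delta> *\<^sub>R v"
    have "norm w' \<le> (1 - \<delta>) * norm w + \<delta> * norm v"
      unfolding w'_def using \<delta> by (intro norm_triangle_le add_mono) auto
    also have "\<dots> \<le> (1 - \<delta>) * 1 + \<delta> * 1"
      using w v \<delta> by (intro add_mono mult_left_mono) (auto simp: cap_def)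
    finally have "norm w' \<le> 1" by simp
    moreover have "w' \<in> coord_hyperplane" using w v by (auto simp: w'_def cap_def coord_hyperplane_def)
    moreover have "v \<bullet> v = 1" using v by (simp add: dot_square_norm)
    then have "\<delta> \<le> v \<bullet> w'" using w \<delta> by (simp add: w'_def cap_def inner_add_right)
    ultimately have "w' \<in> cap v \<delta>" by (simp add: cap_def)
    moreover have "w = (1 / (1 - \<delta>)) *\<^sub>R (w' - \<delta> *\<^sub>R v)" using \<delta> by (simp add: w'_def)
    ultimately show "w \<in> (\<lambda>w. (1 / (1 - \<delta>)) *\<^sub>R (w - \<delta> *\<^sub>R v)) ` cap v \<delta>" by blast
  qed
  also have "\<dots> \<le> ennreal ((1 / (1 - \<delta>)) ^ k) * ?H (cap v \<delta>)"
    using \<delta> by (intro hausdorff_measure_Lipschitz_image)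
      (auto simp: dist_norm scaleR_diff_right[symmetric] simp del: scaleR_diff_right)
  finally have *: "?H ?B \<le> 2 * (ennreal ((1 / (1 - \<delta>)) ^ k) * ?H (cap v \<delta>))"
    by (simp add: mult_left_mono)
  have "ennreal ((1 - \<delta>) ^ k / 2) * ?H ?B
      \<le> ennreal ((1 - \<delta>) ^ k / 2) * (2 * (ennreal ((1 / (1 - \<delta>)) ^ k) * ?H (cap v \<delta>)))"
    using * by (rule mult_left_mono) simp
  also have "\<dots> = ennreal ((1 - \<delta>) ^ k / 2 * 2 * (1 / (1 - \<delta>)) ^ k) * ?H (cap v \<delta>)"
  proof -
    have "ennreal ((1 - \<delta>) ^ k / 2 * 2 * (1 / (1 - \<delta>)) ^ k)
        = ennreal ((1 - \<delta>) ^ k / 2) * ennreal 2 * ennreal ((1 / (1 - \<delta>)) ^ k)"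
      using \<delta> by (simp only: ennreal_mult zero_le_power divide_nonneg_nonneg mult_nonneg_nonneg
        diff_ge_0_iff_ge less_imp_le zero_le_one zero_le_numeral)
    then show ?thesis by (simp add: mult.assoc)
  qed
  also have "(1 - \<delta>) ^ k / 2 * 2 * (1 / (1 - \<delta>)) ^ k = 1"
    using \<delta> by (simp add: power_divide)
  finally show ?thesis by simp
qed

text \<open>If \<open>S\<close> contains two disjoint compact pieces, one lying over a full disc of radius \<open>s\<close> and one
  over almost a half disc of that radius, then the ratio defining the density of \<open>S\<close> at radius \<open>r\<close> is at
  least \<open>(s / r) ^ k\<close> times a number close to \<open>3 / 2\<close> for small \<open>\<delta>\<close>.  The map \<open>g\<close> is the projection to the disc, rescaled to
  radius one.\<close>

lemma two_sheets_density:
  fixes g :: "real ^ 'n \<Rightarrow> real ^ 'n"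
  defines "k \<equiv> CARD('n) - 1"
  assumes \<delta>: "0 < \<delta>" "\<delta> < 1" and v: "v \<in> coord_hyperplane" "norm v = 1" and s: "0 < s" "0 < r"
    and g: "\<And>x y. dist (g x) (g y) \<le> (1 / s) * dist x y"
    and A: "compact A" "coord_hyperplane \<inter> cball 0 1 \<subseteq> g ` A"
    and B: "compact B" "cap v \<delta> \<subseteq> g ` B"
    and S: "A \<inter> B = {}" "A \<union> B \<subseteq> S"
  shows "ennreal ((s / r) ^ k * (1 + (1 - \<delta>) ^ k / 2)) \<le> 
    hausdorff_measure k S / hausdorff_measure k (coord_hyperplane \<inter> cball (0 :: real ^ 'n) r)"
proof -
  let ?H = "hausdorff_measure k :: (real ^ 'n) set \<Rightarrow> ennreal"
  define c where "c = ?H (coord_hyperplane \<inter> cball 0 1)"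
  have c: "0 < c" "c < top"
    using hausdorff_measure_disc_pos[where 'n = 'n] hausdorff_measure_disc_finite[where 'n = 'n]
    by (auto simp: c_def k_def)
  obtain d where d: "0 < d" "\<And>x y. x \<in> A \<Longrightarrow> y \<in> B \<Longrightarrow> d \<le> dist x y"
    using separate_compact_closed[OF A(1) compact_imp_closed[OF B(1)] S(1)] by blast
  have "c \<le> ?H (g ` A)" unfolding c_def by (rule hausdorff_measure_mono[OF A(2)])
  also have "\<dots> \<le> ennreal ((1 / s) ^ k) * ?H A"
    using s g by (intro hausdorff_measure_Lipschitz_image) auto
  finally have 1: "c \<le> ennreal ((1 / s) ^ k) * ?H A" .
  have "ennreal ((1 - \<delta>) ^ k / 2) * c \<le> ?H (cap v \<delta>)"
    unfolding c_def by (rule hausdorff_measure_cap_ge[OF \<delta> v])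
  also have "\<dots> \<le> ?H (g ` B)" by (rule hausdorff_measure_mono[OF B(2)])
  also have "\<dots> \<le> ennreal ((1 / s) ^ k) * ?H B"
    using s g by (intro hausdorff_measure_Lipschitz_image) auto
  finally have 2: "ennreal ((1 - \<delta>) ^ k / 2) * c \<le> ennreal ((1 / s) ^ k) * ?H B" .
  have "ennreal (1 + (1 - \<delta>) ^ k / 2) * c = c + ennreal ((1 - \<delta>) ^ k / 2) * c"
    using \<delta> by (simp add: distrib_right)
  also have "\<dots> \<le> ennreal ((1 / s) ^ k) * (?H A + ?H B)"
    unfolding distrib_left using 1 2 by (rule add_mono)
  also have "\<dots> \<le> ennreal ((1 / s) ^ k) * ?H S"
    using order_trans[OF hausdorff_measure_separated[OF d(1)] hausdorff_measure_mono[OF S(2)]] d(2)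
    by (intro mult_left_mono) auto
  finally have 3: "ennreal (1 + (1 - \<delta>) ^ k / 2) * c \<le> ennreal ((1 / s) ^ k) * ?H S" .
  have "coord_hyperplane \<inter> cball 0 r \<subseteq> (\<lambda>x. r *\<^sub>R x) ` (coord_hyperplane \<inter> cball (0 :: real ^ 'n) 1)"
  proof
    fix x :: "real ^ 'n" assume "x \<in> coord_hyperplane \<inter> cball 0 r"
    then have "(1 / r) *\<^sub>R x \<in> coord_hyperplane \<inter> cball 0 1" "x = r *\<^sub>R ((1 / r) *\<^sub>R x)"
      using s by (auto simp: coord_hyperplane_def)
    then show "x \<in> (\<lambda>x. r *\<^sub>R x) ` (coord_hyperplane \<inter> cball (0 :: real ^ 'n) 1)" by blast
  qed
  then have "?H (coord_hyperplane \<inter> cball 0 r)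
      \<le> ?H ((\<lambda>x. r *\<^sub>R x) ` (coord_hyperplane \<inter> cball (0 :: real ^ 'n) 1))"
    by (rule hausdorff_measure_mono)
  also have "\<dots> \<le> ennreal (r ^ k) * c" unfolding c_def using s(2)
    by (intro hausdorff_measure_Lipschitz_image)
      (auto simp: dist_norm scaleR_diff_right[symmetric] simp del: scaleR_diff_right)
  finally have 4: "?H (coord_hyperplane \<inter> cball 0 r) \<le> ennreal (r ^ k) * c" .
  have "ennreal ((s / r) ^ k * (1 + (1 - \<delta>) ^ k / 2)) * (ennreal (r ^ k) * c)
      = ennreal (s ^ k) * (ennreal (1 + (1 - \<delta>) ^ k / 2) * c)"
  proof -
    let ?w = "1 + (1 - \<delta>) ^ k / 2"
    have assoc: "ennreal x * (ennreal y * c) = ennreal (x * y) * c" if "0 \<le> x" "0 \<le> y" for x y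
      using that by (simp add: ennreal_mult mult.assoc)
    have w: "0 \<le> ?w" using \<delta> by simp
    have "ennreal ((s / r) ^ k * ?w) * (ennreal (r ^ k) * c) = ennreal ((s / r) ^ k * ?w * r ^ k) * c"
      using s w by (intro assoc mult_nonneg_nonneg) auto
    also have "(s / r) ^ k * ?w * r ^ k = s ^ k * ?w"
      using s by (simp add: power_divide)
    also have "ennreal (s ^ k * ?w) * c = ennreal (s ^ k) * (ennreal ?w * c)"
      using s w by (intro assoc[symmetric]) auto
    finally show ?thesis .
  qed
  also have "\<dots> \<le> ennreal (s ^ k) * (ennreal ((1 / s) ^ k) * ?H S)" using 3 by (rule mult_left_mono) simp
  also have "\<dots> = ?H S"
    using s by (simp add: mult.assoc[symmetric] ennreal_mult[symmetric] power_divide)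
  finally have "ennreal ((s / r) ^ k * (1 + (1 - \<delta>) ^ k / 2)) * (ennreal (r ^ k) * c) \<le> ?H S" .
  then have "ennreal ((s / r) ^ k * (1 + (1 - \<delta>) ^ k / 2)) \<le> ?H S / (ennreal (r ^ k) * c)"
  proof -
    let ?y = "ennreal (r ^ k) * c"
    have y: "?y \<noteq> 0" "?y < top" using s c by (auto simp: ennreal_mult_less_top)
    assume "ennreal ((s / r) ^ k * (1 + (1 - \<delta>) ^ k / 2)) * ?y \<le> ?H S"
    then have "ennreal ((s / r) ^ k * (1 + (1 - \<delta>) ^ k / 2)) * ?y / ?y \<le> ?H S / ?y"
      by (rule divide_right_mono_ennreal)
    then show ?thesis using y by (simp add: mult_divide_eq_ennreal)
  qed
  also have "\<dots> \<le> ?H S / ?H (coord_hyperplane \<inter> cball 0 r)"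
    using 4 unfolding divide_ennreal_def by (intro mult_left_mono ennreal_inverse_antimono) auto
  finally show ?thesis .
qed

section \<open>Openness of the projection along a transversal direction\<close>

text \<open>For a unit vector \<open>a\<close>, the orthogonal projection along \<open>a\<close>.\<close>

definition perp :: "'a::real_inner \<Rightarrow> 'a \<Rightarrow> 'a" where
  "perp a x = x - (a \<bullet> x) *\<^sub>R a"

lemma perp_simps:
  "perp a (x + y) = perp a x + perp a y" "perp a (x - y) = perp a x - perp a y"
  "perp a (c *\<^sub>R x) = c *\<^sub>R perp a x" "perp a (- x) = - perp a x" "perp a 0 = 0" "perp (- a) x = perp a x"
  by (simp_all add: perp_def algebra_simps)

lemma perp_decomp: "x = perp a x + (a \<bullet> x) *\<^sub>R a"
  by (simp add: perp_def)

lemma perp_eq_self: "a \<bullet> x = 0 \<Longrightarrow> perp a x = x"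
  by (simp add: perp_def)

lemma perp_unit:
  assumes "norm a = 1"
  shows "perp a a = 0" "a \<bullet> perp a x = 0" "norm (perp a x) \<le> norm x" "\<bar>a \<bullet> x\<bar> \<le> norm x"
    "norm x \<le> norm (perp a x) + \<bar>a \<bullet> x\<bar>"
proof -
  have aa: "a \<bullet> a = 1" using assms by (simp add: dot_square_norm)
  show "perp a a = 0" "a \<bullet> perp a x = 0" by (simp_all add: perp_def aa inner_diff_right)
  have "(norm (perp a x))\<^sup>2 = (norm x)\<^sup>2 - (a \<bullet> x)\<^sup>2"
    unfolding power2_norm_eq_inner
    by (simp add: perp_def inner_diff_left inner_diff_right aa inner_commute power2_eq_square)
  then have "(norm (perp a x))\<^sup>2 \<le> (norm x)\<^sup>2" by simp
  then show "norm (perp a x) \<le> norm x" by (rule power2_le_imp_le) simp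
  show "\<bar>a \<bullet> x\<bar> \<le> norm x" using Cauchy_Schwarz_ineq2[of a x] assms by simp
  show "norm x \<le> norm (perp a x) + \<bar>a \<bullet> x\<bar>"
    using norm_triangle_ineq[of "perp a x" "(a \<bullet> x) *\<^sub>R a"] assms by (simp add: perp_decomp[symmetric])
qed

lemma continuous_on_perp [continuous_intros]:
  "continuous_on S f \<Longrightarrow> continuous_on S (\<lambda>x. perp a (f x))"
  unfolding perp_def by (intro continuous_intros)

text \<open>What is used of the tangent cones, with \<open>\<nu> q\<close> a unit normal of \<open>T\<^sub>qX\<close>: \<open>near\<close> says that every
  tangent ray is orthogonal to \<open>\<nu> q\<close>, \<open>dirs\<close> that every ray orthogonal to \<open>\<nu> q\<close> is tangent, and \<open>cont\<close>
  that the hyperplane varies continuously.  The sign of \<open>\<nu>\<close> is chosen pointwise, so continuity can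
  only be asserted up to sign.\<close>

locale tangent_field =
  fixes X :: "'a::euclidean_space set" and \<nu> :: "'a \<Rightarrow> 'a"
  assumes locally_compact: "p \<in> X \<Longrightarrow> \<exists>\<rho>>0. compact (X \<inter> cball p \<rho>)"
    and unit: "q \<in> X \<Longrightarrow> norm (\<nu> q) = 1"
    and near: "q \<in> X \<Longrightarrow> 0 < e \<Longrightarrow> \<exists>d>0. \<forall>x\<in>X. dist x q < d \<longrightarrow> \<bar>\<nu> q \<bullet> (x - q)\<bar> \<le> e * norm (x - q)"
    and dirs: "q \<in> X \<Longrightarrow> norm u = 1 \<Longrightarrow> \<nu> q \<bullet> u = 0 \<Longrightarrow> 0 < e \<Longrightarrow> 0 < d \<Longrightarrow>
        \<exists>x\<in>X. 0 < dist x q \<and> dist x q < d \<and> norm (sgn (x - q) - u) < e"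
    and cont: "q \<in> X \<Longrightarrow> 0 < e \<Longrightarrow>
        \<exists>d>0. \<forall>x\<in>X. dist x q < d \<longrightarrow> norm (\<nu> x - \<nu> q) < e \<or> norm (\<nu> x + \<nu> q) < e"
begin

text \<open>The projection \<open>X \<rightarrow> a\<^sup>\<bottom>\<close> is open near \<open>q\<close> when \<open>a\<close> is transversal to the tangent hyperplanes.
  Take a small ball about \<open>q\<close> in which \<open>q\<close> is alone in its fibre; the boundary sphere then projects to
  distance at least some \<open>m > 0\<close> from the projection of \<open>q\<close>.  If some \<open>z\<close> within \<open>m / 2\<close> were missed, let \<open>x'\<close> be a point of \<open>X\<close> in
  the ball whose projection is nearest to \<open>z\<close>.  It is interior to the ball, and since \<open>T\<^bsub>x'\<^esub>X\<close> is a full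
  hyperplane transversal to \<open>a\<close>, there are points of \<open>X\<close> near \<open>x'\<close> whose projection moves towards \<open>z\<close>,
  a contradiction.\<close>

lemma projection_open:
  assumes q: "q \<in> X" and a: "norm a = 1" and e0: "0 < e0" and cpt: "compact (X \<inter> cball q e0)"
    and tr: "\<And>x. x \<in> X \<Longrightarrow> dist x q \<le> e0 \<Longrightarrow> \<nu> x \<bullet> a \<noteq> 0" and e: "0 < e"
  shows "\<exists>d>0. \<forall>z. norm (perp a (z - q)) < d \<longrightarrow> (\<exists>x\<in>X. dist x q < e \<and> perp a (x - z) = 0)"
proof -
  have \<nu>a: "0 < \<bar>\<nu> q \<bullet> a\<bar>" using tr[OF q] e0 by simp
  obtain d1 where d1: "0 < d1"
    "\<And>x. x \<in> X \<Longrightarrow> dist x q < d1 \<Longrightarrow> \<bar>\<nu> q \<bullet> (x - q)\<bar> \<le> \<bar>\<nu> q \<bullet> a\<bar> / 2 * norm (x - q)"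
    using near[OF q, of "\<bar>\<nu> q \<bullet> a\<bar> / 2"] \<nu>a by auto
  define e1 where "e1 = min (min (e / 2) e0) (d1 / 2)"
  have e1: "0 < e1" "e1 < e" "e1 \<le> e0" "e1 < d1" using e e0 d1 by (auto simp: e1_def)
  define L where "L = X \<inter> cball q e1"
  have "L = (X \<inter> cball q e0) \<inter> cball q e1" using e1 by (auto simp: L_def)
  then have cL: "compact L" using cpt by (simp add: compact_Int_closed)
  have iso: "x = q" if x: "x \<in> L" "perp a (x - q) = 0" for x
  proof -
    define t where "t = a \<bullet> (x - q)"
    have xq: "x - q = t *\<^sub>R a" using perp_decomp[of "x - q" a] x by (simp add: t_def)
    have "\<bar>\<nu> q \<bullet> (x - q)\<bar> \<le> \<bar>\<nu> q \<bullet> a\<bar> / 2 * norm (x - q)"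
      using x e1 by (intro d1) (auto simp: L_def dist_commute)
    then have "\<bar>t\<bar> * \<bar>\<nu> q \<bullet> a\<bar> \<le> \<bar>t\<bar> * \<bar>\<nu> q \<bullet> a\<bar> / 2" unfolding xq using a by (simp add: abs_mult mult_ac)
    then have "\<bar>t\<bar> * \<bar>\<nu> q \<bullet> a\<bar> = 0" by (smt (verit) mult_nonneg_nonneg abs_ge_zero field_sum_of_halves)
    then show ?thesis using xq \<nu>a by simp
  qed
  have cL': "compact (L \<inter> sphere q e1)" using cL by (simp add: compact_Int_closed)
  obtain m where m: "0 < m" "\<And>x. x \<in> L \<inter> sphere q e1 \<Longrightarrow> m \<le> norm (perp a (x - q))"
  proof (cases "L \<inter> sphere q e1 = {}")
    case True then show ?thesis using that[of 1] by auto
  next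
    case False
    have "continuous_on (L \<inter> sphere q e1) (\<lambda>x. norm (perp a (x - q)))" by (intro continuous_intros)
    then obtain y where y: "y \<in> L \<inter> sphere q e1"
      "\<And>x. x \<in> L \<inter> sphere q e1 \<Longrightarrow> norm (perp a (y - q)) \<le> norm (perp a (x - q))"
      using continuous_attains_inf[OF cL' False] by blast
    have "norm (perp a (y - q)) > 0" using iso[of y] y(1) e1(1) by auto
    then show ?thesis using that y(2) by blast
  qed
  have "\<exists>x\<in>X. dist x q < e \<and> perp a (x - z) = 0" if z: "norm (perp a (z - q)) < m / 2" for z
  proof (rule ccontr)
    assume no: "\<not> ?thesis"
    have qL: "q \<in> L" using q e1 by (simp add: L_def)
    have "continuous_on L (\<lambda>x. norm (perp a (z - x)))" by (intro continuous_intros)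
    then obtain x' where x': "x' \<in> L" "\<And>x. x \<in> L \<Longrightarrow> norm (perp a (z - x')) \<le> norm (perp a (z - x))"
      using continuous_attains_inf[OF cL] qL by blast
    have x'X: "x' \<in> X" "dist x' q \<le> e1" using x'(1) by (auto simp: L_def dist_commute)
    define w where "w = perp a (z - x')"
    have aw: "a \<bullet> w = 0" by (simp add: w_def perp_unit[OF a])
    have "perp a (x' - z) = - w" by (simp add: w_def perp_simps)
    then have w0: "w \<noteq> 0" using no x'X e1 by auto
    have "perp a (x' - q) = perp a (z - q) - w" by (simp add: w_def perp_simps)
    then have "norm (perp a (x' - q)) \<le> norm (perp a (z - q)) + norm w" by (simp add: norm_triangle_ineq4)
    also have "\<dots> < m" using z x'(2)[OF qL] by (simp add: w_def)
    finally have "x' \<notin> sphere q e1" using m(2)[of x'] x'(1) by auto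
    then have x'e: "dist x' q < e1" using x'X by (auto simp: dist_commute)
    \<comment> \<open>\<open>u0\<close> is the lift of \<open>w\<close> to the tangent hyperplane at \<open>x'\<close>\<close>
    define s where "s = - (\<nu> x' \<bullet> w) / (\<nu> x' \<bullet> a)"
    define u0 where "u0 = w + s *\<^sub>R a"
    have "\<nu> x' \<bullet> a \<noteq> 0" using x'X e1 by (intro tr) auto
    then have \<nu>u0: "\<nu> x' \<bullet> u0 = 0" by (simp add: u0_def s_def inner_add_right inner_diff_right)
    have "perp a u0 = w" using aw by (simp add: u0_def perp_simps perp_unit[OF a] perp_eq_self)
    then have u0: "u0 \<noteq> 0" using w0 by (auto simp: perp_simps)
    have wu0: "w \<bullet> u0 = (norm w)\<^sup>2" using aw by (simp add: u0_def inner_add_right inner_commute dot_square_norm)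
    define \<kappa> where "\<kappa> = norm w / (2 * norm u0)"
    have \<kappa>: "0 < \<kappa>" using w0 u0 by (simp add: \<kappa>_def)
    \<comment> \<open>a step of length less than \<open>(norm w)\<^sup>2 / norm u0\<close> in about the direction \<open>u0\<close> reduces the distance to \<open>z\<close>\<close>
    have "0 < min (e1 - dist x' q) ((norm w)\<^sup>2 / norm u0)" using x'e w0 u0 by simp
    moreover have "norm (sgn u0) = 1" "\<nu> x' \<bullet> sgn u0 = 0" using u0 \<nu>u0 by (auto simp: sgn_div_norm norm_sgn)
    ultimately obtain x where x: "x \<in> X" "0 < dist x x'" "dist x x' < e1 - dist x' q"
        "dist x x' < (norm w)\<^sup>2 / norm u0" "norm (sgn (x - x') - sgn u0) < \<kappa>"
      using dirs[OF x'X(1), of "sgn u0" \<kappa> "min (e1 - dist x' q) ((norm w)\<^sup>2 / norm u0)"] \<kappa> by auto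
    define \<tau> where "\<tau> = norm (x - x')"
    have \<tau>: "0 < \<tau>" "\<tau> < (norm w)\<^sup>2 / norm u0" using x by (auto simp: \<tau>_def dist_norm)
    have "x - x' = \<tau> *\<^sub>R sgn (x - x')" using \<tau> by (simp add: \<tau>_def sgn_div_norm)
    then have 1: "w \<bullet> (x - x') = \<tau> * (w \<bullet> sgn (x - x'))" by (metis inner_scaleR_right)
    have "\<bar>w \<bullet> (sgn (x - x') - sgn u0)\<bar> \<le> norm w * \<kappa>"
      using Cauchy_Schwarz_ineq2[of w "sgn (x - x') - sgn u0"] x(5)
      by (meson less_imp_le mult_left_mono norm_ge_zero order_trans)
    moreover have "w \<bullet> sgn u0 = (norm w)\<^sup>2 / norm u0" using wu0 by (simp add: sgn_div_norm divide_inverse_commute)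
    moreover have "norm w * \<kappa> = (norm w)\<^sup>2 / norm u0 / 2" by (simp add: \<kappa>_def power2_eq_square)
    ultimately have "(norm w)\<^sup>2 / norm u0 / 2 \<le> w \<bullet> sgn (x - x')" by (simp add: inner_diff_right)
    then have 2: "\<tau> * ((norm w)\<^sup>2 / norm u0) \<le> 2 * (w \<bullet> (x - x'))"
      using mult_left_mono[of "(norm w)\<^sup>2 / norm u0 / 2" "w \<bullet> sgn (x - x')" \<tau>] \<tau> 1 by simp
    have 3: "(norm (perp a (x - x')))\<^sup>2 \<le> \<tau>\<^sup>2"
      using perp_unit(3)[OF a] unfolding \<tau>_def by (intro power_mono) auto
    have "\<tau>\<^sup>2 < \<tau> * ((norm w)\<^sup>2 / norm u0)" using \<tau> by (simp only: power2_eq_square mult_strict_left_mono)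
    moreover have "perp a (z - x) = w - perp a (x - x')" by (simp add: w_def perp_simps)
    then have "(norm (perp a (z - x)))\<^sup>2 = (norm w)\<^sup>2 - 2 * (w \<bullet> perp a (x - x')) + (norm (perp a (x - x')))\<^sup>2"
      by (simp add: power2_norm_eq_inner inner_diff_left inner_diff_right inner_commute)
    moreover have "w \<bullet> perp a (x - x') = w \<bullet> (x - x')" using aw by (simp add: perp_def inner_diff_right inner_commute)
    ultimately have "(norm (perp a (z - x)))\<^sup>2 < (norm w)\<^sup>2" using 2 3 by linarith
    then have "norm (perp a (z - x)) < norm w" by (rule power2_less_imp_less) simp
    moreover have "dist x q < e1" using x(3) dist_triangle[of x q x'] by linarith
    then have "x \<in> L" using x(1) by (simp add: L_def dist_commute)
    ultimately show False using x'(2)[of x] by (simp add: w_def)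
  qed
  then show ?thesis using m(1) by (intro exI[of _ "m / 2"]) auto
qed

text \<open>The part of \<open>X\<close> in a cylinder with axis \<open>a\<close> about \<open>p\<close>.  In a flat cylinder this part is compact,
  lies in a double wedge of slope \<open>\<epsilon>\<close>, has tangent hyperplanes of slope at most \<open>\<epsilon>\<close>, and
  projects onto the whole base.\<close>

definition cyl :: "'a \<Rightarrow> 'a \<Rightarrow> real \<Rightarrow> 'a set" where
  "cyl a p r = {x \<in> X. norm (perp a (x - p)) \<le> r \<and> \<bar>a \<bullet> (x - p)\<bar> \<le> r}"

definition flat_cyl :: "real \<Rightarrow> 'a \<Rightarrow> 'a \<Rightarrow> real \<Rightarrow> bool" where
  "flat_cyl \<epsilon> a p r \<longleftrightarrow> norm a = 1 \<and> 0 < r \<and> compact (cyl a p r) \<and>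
     (\<forall>x\<in>cyl a p r. \<bar>a \<bullet> (x - p)\<bar> \<le> \<epsilon> * norm (perp a (x - p))) \<and>
     (\<forall>x\<in>cyl a p r. \<nu> x \<bullet> a \<noteq> 0 \<and> norm (perp a (\<nu> x)) \<le> \<epsilon> * \<bar>\<nu> x \<bullet> a\<bar>) \<and>
     (\<forall>z. norm (perp a (z - p)) < r \<longrightarrow> (\<exists>x\<in>cyl a p r. perp a (x - z) = 0))"

lemma cyl_minus: "cyl (- a) p r = cyl a p r"
  by (simp add: cyl_def perp_simps)

lemma flat_cyl_minus: "flat_cyl \<epsilon> (- a) p r \<longleftrightarrow> flat_cyl \<epsilon> a p r"
  by (simp add: flat_cyl_def cyl_minus perp_simps)

lemma flat_cyl_exists:
  assumes p: "p \<in> X" and \<epsilon>: "0 < \<epsilon>" "\<epsilon> \<le> 1"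
  shows "\<exists>r. flat_cyl \<epsilon> (\<nu> p) p r"
proof -
  define a where "a = \<nu> p"
  have a: "norm a = 1" using unit[OF p] by (simp add: a_def)
  have aa: "a \<bullet> a = 1" using a by (simp add: dot_square_norm)
  obtain \<rho>0 where \<rho>0: "0 < \<rho>0" "compact (X \<inter> cball p \<rho>0)" using locally_compact[OF p] by blast
  \<comment> \<open>the constant \<open>\<epsilon> / (1 + \<epsilon>)\<close> turns a bound by the full distance into the bound \<open>\<epsilon>\<close> by its horizontal part\<close>
  obtain d1 where d1: "0 < d1"
    "\<And>x. x \<in> X \<Longrightarrow> dist x p < d1 \<Longrightarrow> \<bar>a \<bullet> (x - p)\<bar> \<le> \<epsilon> / (1 + \<epsilon>) * norm (x - p)"
    using near[OF p, of "\<epsilon> / (1 + \<epsilon>)"] \<epsilon> unfolding a_def by auto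
  obtain d2 where d2: "0 < d2"
    "\<And>x. x \<in> X \<Longrightarrow> dist x p < d2 \<Longrightarrow> norm (\<nu> x - a) < \<epsilon> / 2 \<or> norm (\<nu> x + a) < \<epsilon> / 2"
    using cont[OF p, of "\<epsilon> / 2"] \<epsilon> unfolding a_def by auto
  define \<rho> where "\<rho> = min \<rho>0 (min (d1 / 2) (d2 / 2))"
  have \<rho>: "0 < \<rho>" "\<rho> \<le> \<rho>0" "\<rho> < d1" "\<rho> < d2" using \<rho>0 d1 d2 by (auto simp: \<rho>_def)
  have "X \<inter> cball p \<rho> = (X \<inter> cball p \<rho>0) \<inter> cball p \<rho>" using \<rho> by auto
  then have cpt: "compact (X \<inter> cball p \<rho>)" using \<rho>0 by (simp add: compact_Int_closed)
  have cone: "\<bar>a \<bullet> (x - p)\<bar> \<le> \<epsilon> * norm (perp a (x - p))" if x: "x \<in> X" "dist x p \<le> \<rho>" for x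
  proof -
    let ?s = "\<bar>a \<bullet> (x - p)\<bar>" and ?h = "norm (perp a (x - p))"
    have "?s \<le> \<epsilon> / (1 + \<epsilon>) * norm (x - p)" using x \<rho> by (intro d1) auto
    also have "\<dots> \<le> \<epsilon> / (1 + \<epsilon>) * (?h + ?s)" using perp_unit(5)[OF a] \<epsilon> by (intro mult_left_mono) auto
    finally have "?s * (1 + \<epsilon>) \<le> \<epsilon> * (?h + ?s)" using \<epsilon> by (simp add: field_simps)
    then show ?thesis by (simp add: algebra_simps)
  qed
  have slope: "\<nu> x \<bullet> a \<noteq> 0 \<and> norm (perp a (\<nu> x)) \<le> \<epsilon> * \<bar>\<nu> x \<bullet> a\<bar>" if x: "x \<in> X" "dist x p \<le> \<rho>" for x
  proof -
    have "\<exists>b. (b = a \<or> b = - a) \<and> norm (\<nu> x - b) < \<epsilon> / 2"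
      using d2(2)[OF x(1)] x(2) \<rho> by fastforce
    then obtain b where b: "b = a \<or> b = - a" "norm (\<nu> x - b) < \<epsilon> / 2" by blast
    have "perp a b = 0" "\<bar>b \<bullet> a\<bar> = 1" using b(1) aa by (auto simp: perp_simps perp_unit[OF a])
    then have "norm (perp a (\<nu> x)) \<le> norm (\<nu> x - b)"
      using perp_unit(3)[OF a, of "\<nu> x - b"] by (simp add: perp_simps)
    then have 1: "norm (perp a (\<nu> x)) \<le> \<epsilon> / 2" using b by simp
    have "\<bar>(\<nu> x - b) \<bullet> a\<bar> \<le> norm (\<nu> x - b)" using Cauchy_Schwarz_ineq2[of "\<nu> x - b" a] a by simp
    then have "\<bar>\<nu> x \<bullet> a - b \<bullet> a\<bar> < \<epsilon> / 2" using b by (simp add: inner_diff_left)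
    then have 2: "1 / 2 < \<bar>\<nu> x \<bullet> a\<bar>" using \<open>\<bar>b \<bullet> a\<bar> = 1\<close> \<epsilon> by linarith
    then have "\<epsilon> * (1 / 2) \<le> \<epsilon> * \<bar>\<nu> x \<bullet> a\<bar>" using \<epsilon> by (intro mult_left_mono) auto
    then show ?thesis using 1 2 by auto
  qed
  obtain d3 where d3: "0 < d3"
      "\<And>z. norm (perp a (z - p)) < d3 \<Longrightarrow> \<exists>x\<in>X. dist x p < \<rho> \<and> perp a (x - z) = 0"
    using projection_open[OF p a \<rho>(1) cpt _ \<rho>(1)] slope by blast
  define r where "r = min (\<rho> / 2) d3"
  have r: "0 < r" "2 * r \<le> \<rho>" "r \<le> d3" using \<rho> d3 by (auto simp: r_def)
  have in_ball: "x \<in> X \<and> dist x p \<le> \<rho>" if "x \<in> cyl a p r" for x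
    using that perp_unit(5)[OF a, of "x - p"] r unfolding cyl_def dist_norm by auto
  have "flat_cyl \<epsilon> a p r"
    unfolding flat_cyl_def
  proof (intro conjI ballI allI impI a r(1))
    have "cyl a p r = (X \<inter> cball p \<rho>) \<inter> {x. norm (perp a (x - p)) \<le> r \<and> \<bar>a \<bullet> (x - p)\<bar> \<le> r}"
      using in_ball by (auto simp: cyl_def dist_commute)
    moreover have "closed {x. norm (perp a (x - p)) \<le> r \<and> \<bar>a \<bullet> (x - p)\<bar> \<le> r}"
      by (intro closed_Collect_conj closed_Collect_le continuous_intros)
    ultimately show "compact (cyl a p r)" using cpt by (simp add: compact_Int_closed)
  next
    fix z assume z: "norm (perp a (z - p)) < r"
    then obtain x where x: "x \<in> X" "dist x p < \<rho>" "perp a (x - z) = 0" using d3(2)[of z] r by auto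
    have xz: "perp a (x - p) = perp a (z - p)" using x(3) by (simp add: perp_simps)
    have "\<bar>a \<bullet> (x - p)\<bar> \<le> \<epsilon> * norm (perp a (x - p))" using x by (intro cone) auto
    also have "\<dots> \<le> 1 * norm (perp a (x - p))" using \<epsilon> by (intro mult_right_mono) auto
    also have "\<dots> \<le> r" using z xz by simp
    finally show "\<exists>x\<in>cyl a p r. perp a (x - z) = 0"
      using x z xz by (intro bexI[of _ x]) (auto simp: cyl_def)
  qed (use in_ball cone slope in auto)
  then show ?thesis unfolding a_def by blast
qed

text \<open>The gradient of the tangent hyperplane at \<open>x\<close>, viewed as a graph over \<open>a\<^sup>\<bottom>\<close>.  It does not change
  with the sign of \<open>\<nu> x\<close>, and is therefore continuous although \<open>\<nu>\<close> need not be.\<close>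

definition slope :: "'a \<Rightarrow> 'a \<Rightarrow> 'a" where
  "slope a x = - (1 / (\<nu> x \<bullet> a)) *\<^sub>R perp a (\<nu> x)"

lemma continuous_on_slope: "continuous_on {x \<in> X. \<nu> x \<bullet> a \<noteq> 0} (slope a)"
  unfolding continuous_on_iff
proof (intro ballI allI impI)
  fix q and e :: real assume q: "q \<in> {x \<in> X. \<nu> x \<bullet> a \<noteq> 0}" and e: "0 < e"
  define \<phi> where "\<phi> N = - (1 / (N \<bullet> a)) *\<^sub>R perp a N" for N
  have \<phi>_minus: "\<phi> (- N) = \<phi> N" for N by (simp add: \<phi>_def perp_simps)
  have "isCont \<phi> (\<nu> q)" unfolding \<phi>_def perp_def using q by (intro continuous_intros) auto
  then obtain \<eta> where \<eta>: "0 < \<eta>" "\<And>N. dist N (\<nu> q) < \<eta> \<Longrightarrow> dist (\<phi> N) (\<phi> (\<nu> q)) < e"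
    using e unfolding continuous_at_eps_delta by blast
  obtain d where d: "0 < d" "\<And>x. x \<in> X \<Longrightarrow> dist x q < d \<Longrightarrow> norm (\<nu> x - \<nu> q) < \<eta> \<or> norm (\<nu> x + \<nu> q) < \<eta>"
    using cont[of q \<eta>] q \<eta> by auto
  have "dist (slope a x) (slope a q) < e" if x: "x \<in> X" "dist x q < d" for x
  proof -
    have "dist (\<nu> x) (\<nu> q) < \<eta> \<or> dist (- \<nu> x) (\<nu> q) < \<eta>"
      using d(2)[OF x] norm_minus_cancel[of "\<nu> x + \<nu> q"] by (auto simp: dist_norm)
    then have "dist (\<phi> (\<nu> x)) (\<phi> (\<nu> q)) < e" using \<eta>(2) \<phi>_minus by metis
    then show ?thesis by (simp add: slope_def \<phi>_def)
  qed
  then show "\<exists>d>0. \<forall>x\<in>{x \<in> X. \<nu> x \<bullet> a \<noteq> 0}. dist x q < d \<longrightarrow> dist (slope a x) (slope a q) < e"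
    using d(1) by auto
qed

end

section \<open>Top sheets\<close>

definition open_disc :: "'a::real_inner \<Rightarrow> real \<Rightarrow> 'a set" where
  "open_disc a r = {z. a \<bullet> z = 0 \<and> norm z < r}"

context tangent_field
begin

text \<open>A continuous graph inside \<open>X\<close> is differentiable wherever its tangent hyperplane is not
  vertical: the increments \<open>(h, s)\<close> of the graph satisfy \<open>\<bar>s - g \<bullet> h\<bar> \<le> e' * (norm h + \<bar>s\<bar>)\<close>, and for small
  \<open>e'\<close> the term \<open>\<bar>s\<bar>\<close> can be absorbed.\<close>

lemma differentiable_sheet:
  assumes a: "norm a = 1" and zD: "z \<in> D" and q: "q = p + z + f z *\<^sub>R a" and \<nu>a: "\<nu> q \<bullet> a \<noteq> 0"
    and D: "\<And>z'. z' \<in> D \<Longrightarrow> a \<bullet> z' = 0" and fX: "\<And>z'. z' \<in> D \<Longrightarrow> p + z' + f z' *\<^sub>R a \<in> X"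
    and cf: "continuous_on D f"
  shows "(f has_derivative (\<lambda>h. slope a q \<bullet> h)) (at z within D)"
  unfolding has_derivative_within_alt
proof (intro conjI allI impI bounded_linear_inner_right)
  fix \<eta> :: real assume \<eta>: "0 < \<eta>"
  let ?g = "slope a q"
  define e' where "e' = min (1 / 2) (\<eta> / (2 * (1 + norm ?g)))"
  have g1: "0 < 1 + norm ?g" by (simp add: add_pos_nonneg)
  then have e'0: "0 < e'" using \<eta> by (auto simp: e'_def)
  have "e' \<le> 1 / 2" unfolding e'_def by (rule min.cobounded1)
  note e' = e'0 this
  have "e' \<le> \<eta> / (2 * (1 + norm ?g))" by (simp add: e'_def)
  then have "e' * (2 * (1 + norm ?g)) \<le> \<eta>" using g1 by (subst (asm) pos_le_divide_eq) auto
  then have e'g: "2 * e' * (1 + norm ?g) \<le> \<eta>" by (simp only: mult_ac)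
  have qX: "q \<in> X" using fX[OF zD] q by simp
  obtain d where d: "0 < d"
    "\<And>x. x \<in> X \<Longrightarrow> dist x q < d \<Longrightarrow> \<bar>\<nu> q \<bullet> (x - q)\<bar> \<le> e' * \<bar>\<nu> q \<bullet> a\<bar> * norm (x - q)"
    using near[OF qX, of "e' * \<bar>\<nu> q \<bullet> a\<bar>"] e' \<nu>a by auto
  obtain d2 where d2: "0 < d2" "\<And>z'. z' \<in> D \<Longrightarrow> dist z' z < d2 \<Longrightarrow> dist (f z') (f z) < d / 2"
    using cf zD d(1) unfolding continuous_on_iff by (meson half_gt_zero)
  have "\<bar>f z' - f z - ?g \<bullet> (z' - z)\<bar> \<le> \<eta> * norm (z' - z)"
    if z': "z' \<in> D" "norm (z' - z) < min d2 (d / 2)" for z'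
  proof -
    define x where "x = p + z' + f z' *\<^sub>R a"
    define h where "h = z' - z"
    define s where "s = f z' - f z"
    have ah: "a \<bullet> h = 0" using D zD z' by (simp add: h_def inner_diff_right)
    have xq: "x - q = h + s *\<^sub>R a" by (simp add: x_def q h_def s_def algebra_simps)
    have nxq: "norm (x - q) \<le> norm h + \<bar>s\<bar>" unfolding xq using norm_triangle_ineq[of h "s *\<^sub>R a"] a by simp
    have "\<bar>s\<bar> < d / 2" using d2(2)[OF z'(1)] z'(2) by (simp add: s_def dist_norm)
    then have "dist x q < d" using nxq z' by (simp add: dist_norm h_def)
    then have "\<bar>\<nu> q \<bullet> (x - q)\<bar> \<le> e' * \<bar>\<nu> q \<bullet> a\<bar> * norm (x - q)"
      using fX[OF z'(1)] by (intro d(2)) (auto simp: x_def)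
    also have "\<dots> \<le> e' * \<bar>\<nu> q \<bullet> a\<bar> * (norm h + \<bar>s\<bar>)" using nxq e' by (intro mult_left_mono) auto
    also have "\<nu> q \<bullet> (x - q) = (\<nu> q \<bullet> a) * (s - ?g \<bullet> h)"
    proof -
      have "perp a (\<nu> q) \<bullet> h = \<nu> q \<bullet> h" using ah by (simp add: perp_def inner_diff_left)
      then show ?thesis using \<nu>a unfolding xq slope_def by (simp add: inner_add_right field_simps)
    qed
    finally have "\<bar>\<nu> q \<bullet> a\<bar> * \<bar>s - ?g \<bullet> h\<bar> \<le> \<bar>\<nu> q \<bullet> a\<bar> * (e' * (norm h + \<bar>s\<bar>))"
      by (simp add: abs_mult mult_ac)
    then have 1: "\<bar>s - ?g \<bullet> h\<bar> \<le> e' * (norm h + \<bar>s\<bar>)" using \<nu>a by simp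
    have "\<bar>?g \<bullet> h\<bar> \<le> norm ?g * norm h" by (rule Cauchy_Schwarz_ineq2)
    then have "\<bar>s\<bar> \<le> \<bar>s - ?g \<bullet> h\<bar> + norm ?g * norm h" by linarith
    then have "e' * (norm h + \<bar>s\<bar>) \<le> e' * (norm h + (\<bar>s - ?g \<bullet> h\<bar> + norm ?g * norm h))"
      using e' by (intro mult_left_mono) auto
    also have "\<dots> = e' * \<bar>s - ?g \<bullet> h\<bar> + e' * (1 + norm ?g) * norm h" by (simp add: algebra_simps)
    finally have 2: "e' * (norm h + \<bar>s\<bar>) \<le> e' * \<bar>s - ?g \<bullet> h\<bar> + e' * (1 + norm ?g) * norm h" .
    have "e' * \<bar>s - ?g \<bullet> h\<bar> \<le> 1 / 2 * \<bar>s - ?g \<bullet> h\<bar>" using e' by (intro mult_right_mono) auto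
    then have "\<bar>s - ?g \<bullet> h\<bar> \<le> 1 / 2 * \<bar>s - ?g \<bullet> h\<bar> + e' * (1 + norm ?g) * norm h"
      using order_trans[OF order_trans[OF 1 2] add_right_mono] by blast
    moreover have "x \<le> 2 * y" if "x \<le> 1 / 2 * x + y" for x y :: real using that by simp
    ultimately have "\<bar>s - ?g \<bullet> h\<bar> \<le> 2 * (e' * (1 + norm ?g) * norm h)" by blast
    then have "\<bar>s - ?g \<bullet> h\<bar> \<le> 2 * e' * (1 + norm ?g) * norm h" by (simp only: mult.assoc)
    also have "\<dots> \<le> \<eta> * norm h" using e'g by (intro mult_right_mono) auto
    finally show ?thesis by (simp add: s_def h_def)
  qed
  then show "\<exists>d>0. \<forall>y\<in>D. norm (y - z) < d \<longrightarrow> norm (f y - f z - ?g \<bullet> (y - z)) \<le> \<eta> * norm (y - z)"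
    using d2(1) d(1) by (intro exI[of _ "min d2 (d / 2)"]) auto
qed

text \<open>\<open>f\<close> is the highest point of \<open>X\<close> in each fibre of the cylinder, and \<open>g\<close> its gradient.  Replacing
  \<open>a\<close> by \<open>- a\<close> gives the lowest point.\<close>

definition is_top_sheet :: "real \<Rightarrow> 'a \<Rightarrow> 'a \<Rightarrow> real \<Rightarrow> ('a \<Rightarrow> real) \<Rightarrow> ('a \<Rightarrow> 'a) \<Rightarrow> bool" where
  "is_top_sheet \<epsilon> a p r f g \<longleftrightarrow>
     (\<forall>z\<in>open_disc a r. p + z + f z *\<^sub>R a \<in> cyl a p r \<and>
        (\<forall>t. p + z + t *\<^sub>R a \<in> cyl a p r \<longrightarrow> t \<le> f z) \<and> \<bar>f z\<bar> \<le> \<epsilon> * norm z \<and>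
        a \<bullet> g z = 0 \<and> norm (g z) \<le> \<epsilon> \<and>
        (f has_derivative (\<lambda>h. g z \<bullet> h)) (at z within open_disc a r)) \<and>
     continuous_on (open_disc a r) f \<and> continuous_on (open_disc a r) g"

text \<open>The supremum of each fibre is attained, and depends continuously on the base point: it
  cannot drop because the projection is open at the top point, and it cannot jump up because the
  cylinder part is compact.  Differentiability then comes for free, with the continuous gradient
  \<open>slope\<close>.\<close>

lemma top_sheet_exists:
  assumes \<epsilon>: "0 < \<epsilon>" "\<epsilon> \<le> 1" and fb: "flat_cyl \<epsilon> a p r"
  shows "\<exists>f g. is_top_sheet \<epsilon> a p r f g"
proof -
  let ?D = "open_disc a r" and ?K = "cyl a p r"
  have a: "norm a = 1" and r: "0 < r" and cK: "compact ?K"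
    and cone: "\<And>x. x \<in> ?K \<Longrightarrow> \<bar>a \<bullet> (x - p)\<bar> \<le> \<epsilon> * norm (perp a (x - p))"
    and slp: "\<And>x. x \<in> ?K \<Longrightarrow> \<nu> x \<bullet> a \<noteq> 0" "\<And>x. x \<in> ?K \<Longrightarrow> norm (perp a (\<nu> x)) \<le> \<epsilon> * \<bar>\<nu> x \<bullet> a\<bar>"
    and surj: "\<And>z. norm (perp a (z - p)) < r \<Longrightarrow> \<exists>x\<in>?K. perp a (x - z) = 0"
    using fb unfolding flat_cyl_def by auto
  have aa: "a \<bullet> a = 1" using a by (simp add: dot_square_norm)
  have KX: "?K \<subseteq> X" by (auto simp: cyl_def)
  have coord: "perp a (p + z + t *\<^sub>R a - p) = z" "a \<bullet> (p + z + t *\<^sub>R a - p) = t" if "a \<bullet> z = 0" for z t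
    using that aa by (auto simp: perp_simps perp_unit[OF a] perp_eq_self inner_add_right add_diff_eq)
  define fib where "fib z = {t. p + z + t *\<^sub>R a \<in> ?K}" for z
  have small: "\<bar>t\<bar> \<le> \<epsilon> * norm z" if "a \<bullet> z = 0" "t \<in> fib z" for z t
    using cone[of "p + z + t *\<^sub>R a"] coord[OF that(1), of t] that(2) by (simp add: fib_def)
  have ne: "fib z \<noteq> {}" if "z \<in> ?D" for z
  proof -
    have z: "a \<bullet> z = 0" "norm z < r" using that by (auto simp: open_disc_def)
    have "norm (perp a (p + z - p)) < r" using z by (simp add: perp_eq_self)
    then obtain x where x: "x \<in> ?K" "perp a (x - (p + z)) = 0" using surj by blast
    have "x = p + z + (a \<bullet> (x - (p + z))) *\<^sub>R a" using perp_decomp[of "x - (p + z)" a] x(2)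
      by (simp add: algebra_simps)
    then show ?thesis using x(1) unfolding fib_def by (metis empty_iff mem_Collect_eq)
  qed
  have clf: "closed (fib z)" for z
  proof -
    have "fib z = (\<lambda>t. p + z + t *\<^sub>R a) -` ?K" by (auto simp: fib_def)
    then show ?thesis using compact_imp_closed[OF cK]
      by (auto intro!: continuous_closed_vimage continuous_intros)
  qed
  have bdd: "bdd_above (fib z)" if "a \<bullet> z = 0" for z
    using small[OF that] by (intro bdd_aboveI[of _ "\<epsilon> * norm z"]) (auto simp: abs_le_iff)
  define f where "f z = Sup (fib z)" for z
  have fin: "p + z + f z *\<^sub>R a \<in> ?K" and fmax: "\<And>t. p + z + t *\<^sub>R a \<in> ?K \<Longrightarrow> t \<le> f z" and az: "a \<bullet> z = 0"
    and fsm: "\<bar>f z\<bar> \<le> \<epsilon> * norm z"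
    if "z \<in> ?D" for z
  proof -
    show az: "a \<bullet> z = 0" using that by (simp add: open_disc_def)
    have "f z \<in> fib z" unfolding f_def by (rule closed_contains_Sup[OF ne[OF that] bdd[OF az] clf])
    then show "p + z + f z *\<^sub>R a \<in> ?K" by (simp add: fib_def)
    show "\<bar>f z\<bar> \<le> \<epsilon> * norm z" using small[OF az \<open>f z \<in> fib z\<close>] .
    show "t \<le> f z" if "p + z + t *\<^sub>R a \<in> ?K" for t
      unfolding f_def using that bdd[OF az] by (intro cSup_upper) (auto simp: fib_def)
  qed
  have "continuous_on ?D f"
    unfolding continuous_on_iff
  proof (intro ballI allI impI)
    fix z and e :: real assume z: "z \<in> ?D" and e: "0 < e"
    have nz: "norm z < r" using z by (simp add: open_disc_def)
    define q where "q = p + z + f z *\<^sub>R a"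
    have qK: "q \<in> ?K" unfolding q_def by (rule fin[OF z])
    have qc: "perp a (q - p) = z" "a \<bullet> (q - p) = f z" using coord[OF az[OF z], of "f z"] by (simp_all add: q_def)
    have fz: "\<bar>f z\<bar> \<le> norm z" using fsm[OF z] \<epsilon> mult_right_mono[of \<epsilon> 1 "norm z"] by simp
    define e0 where "e0 = r - norm z"
    have inK: "x \<in> ?K" if "x \<in> X" "dist x q \<le> e0" for x
    proof -
      have xp: "x - p = (x - q) + (q - p)" by simp
      have "norm (perp a (x - q)) \<le> e0" "\<bar>a \<bullet> (x - q)\<bar> \<le> e0"
        using that(2) perp_unit(3,4)[OF a, of "x - q"] by (auto simp: dist_norm)
      moreover have "perp a (x - p) = perp a (x - q) + z" "a \<bullet> (x - p) = a \<bullet> (x - q) + f z"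
        unfolding xp perp_simps(1) inner_add_right by (simp_all only: qc)
      ultimately show ?thesis using that(1) fz norm_triangle_ineq[of "perp a (x - q)" z]
        unfolding cyl_def e0_def by auto
    qed
    have "X \<inter> cball q e0 = ?K \<inter> cball q e0" using inK KX by (auto simp: dist_commute)
    then have cpt: "compact (X \<inter> cball q e0)" using cK by (simp add: compact_Int_closed)
    have e0: "0 < e0" "0 < min e0 e" using nz e by (auto simp: e0_def)
    obtain d1 where d1: "0 < d1"
      "\<And>y. norm (perp a (y - q)) < d1 \<Longrightarrow> \<exists>x\<in>X. dist x q < min e0 e \<and> perp a (x - y) = 0"
      using projection_open[OF _ a e0(1) cpt _ e0(2)] qK KX slp(1) inK by blast
    \<comment> \<open>openness of the projection lifts nearby base points to points of \<open>X\<close> near \<open>q\<close>\<close>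
    have lower: "f z - e < f z'" if z': "z' \<in> ?D" "norm (z' - z) < d1" for z'
    proof -
      have "perp a ((p + z') - q) = z' - z"
        using qc(1) perp_eq_self[OF az[OF z'(1)]] unfolding perp_simps by (simp add: algebra_simps)
      then obtain x where x: "x \<in> X" "dist x q < e0" "dist x q < e" "perp a (x - (p + z')) = 0"
        using d1(2)[of "p + z'"] z'(2) by auto
      define t where "t = a \<bullet> (x - (p + z'))"
      have xt: "x = p + z' + t *\<^sub>R a" using perp_decomp[of "x - (p + z')" a] x(4)
        by (simp add: t_def algebra_simps)
      have "t \<le> f z'" using inK[OF x(1)] x(2) xt by (intro fmax z'(1)) auto
      moreover have "a \<bullet> (x - q) = t - f z"
        using az[OF z] az[OF z'(1)] aa by (simp add: xt q_def inner_add_right inner_diff_right)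
      ultimately show ?thesis using perp_unit(4)[OF a, of "x - q"] x(3) by (simp add: dist_norm)
    qed
    \<comment> \<open>the points that are too high form a compact set, and its projection misses \<open>z\<close>\<close>
    define K' where "K' = ?K \<inter> {x. f z + e \<le> a \<bullet> (x - p)}"
    have "closed {x. f z + e \<le> a \<bullet> (x - p)}" by (intro closed_Collect_le continuous_intros)
    then have "compact K'" unfolding K'_def using cK by (rule compact_Int_closed[rotated])
    then have "closed ((\<lambda>x. perp a (x - p)) ` K')"
      by (intro compact_imp_closed compact_continuous_image continuous_intros)
    moreover have "z \<notin> (\<lambda>x. perp a (x - p)) ` K'"
    proof
      assume "z \<in> (\<lambda>x. perp a (x - p)) ` K'"
      then obtain x where x: "x \<in> ?K" "f z + e \<le> a \<bullet> (x - p)" "z = perp a (x - p)" by (auto simp: K'_def)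
      have "x = p + z + (a \<bullet> (x - p)) *\<^sub>R a" using perp_decomp[of "x - p" a] x(3) by (simp add: algebra_simps)
      then have "a \<bullet> (x - p) \<le> f z" using fmax[OF z, of "a \<bullet> (x - p)"] x(1) by simp
      then show False using x(2) e by linarith
    qed
    ultimately obtain d2 where d2: "0 < d2" "ball z d2 \<inter> (\<lambda>x. perp a (x - p)) ` K' = {}"
      by (meson open_Compl open_contains_ball ComplI disjoint_eq_subset_Compl)
    have upper: "f z' < f z + e" if z': "z' \<in> ?D" "norm (z' - z) < d2" for z'
    proof (rule ccontr)
      assume "\<not> ?thesis"
      then have "p + z' + f z' *\<^sub>R a \<in> K'" using fin[OF z'(1)] coord(2)[OF az[OF z'(1)], of "f z'"]
        by (simp add: K'_def)
      then have "z' \<in> (\<lambda>x. perp a (x - p)) ` K'"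
        using coord(1)[OF az[OF z'(1)], of "f z'"] by (metis imageI)
      then show False using d2(2) z'(2) by (auto simp: dist_norm norm_minus_commute)
    qed
    show "\<exists>d>0. \<forall>x'\<in>?D. dist x' z < d \<longrightarrow> dist (f x') (f z) < e"
    proof (intro exI[of _ "min d1 d2"] conjI ballI impI)
      fix z' assume "z' \<in> ?D" "dist z' z < min d1 d2"
      then show "dist (f z') (f z) < e" using lower[of z'] upper[of z'] by (simp add: dist_norm abs_less_iff)
    qed (use d1 d2 in auto)
  qed
  note cf = this
  define g where "g z = slope a (p + z + f z *\<^sub>R a)" for z
  have cg: "continuous_on ?D g"
    unfolding g_def
    by (rule continuous_on_compose2[OF continuous_on_slope]) (use fin KX slp(1) cf in \<open>auto intro!: continuous_intros\<close>)
  have "a \<bullet> g z = 0" "norm (g z) \<le> \<epsilon>" if "z \<in> ?D" for z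
    using slp[OF fin[OF that]] by (auto simp: g_def slope_def perp_unit[OF a] field_simps)
  moreover have "(f has_derivative (\<lambda>h. g z \<bullet> h)) (at z within ?D)" if "z \<in> ?D" for z
    unfolding g_def using fin KX slp(1)[OF fin[OF that]]
    by (intro differentiable_sheet[OF a that refl _ _ _ cf]) (auto simp: open_disc_def)
  ultimately show ?thesis unfolding is_top_sheet_def using fin fmax fsm cf cg by blast
qed

end

section \<open>Unit normals of continuous flat tangent cones\<close>

lemma loc_closed_imp_locally_compact:
  fixes X :: "'a::heine_borel set"
  assumes "loc_closed X" "p \<in> X" shows "\<exists>\<rho>>0. compact (X \<inter> cball p \<rho>)"
proof -
  obtain C U where CU: "closed C" "open U" "X = C \<inter> U" using assms(1) by (auto simp: loc_closed_def)
  then obtain \<rho> where \<rho>: "0 < \<rho>" "cball p \<rho> \<subseteq> U" using assms(2) by (auto simp: open_contains_cball)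
  then have "X \<inter> cball p \<rho> = cball p \<rho> \<inter> C" using CU by auto
  then show ?thesis using \<rho>(1) CU(1) compact_Int_closed[OF compact_cball] by metis
qed

lemma hyperplane_normal_unique:
  fixes a :: "'a::euclidean_space"
  assumes a: "norm a = 1" "norm a' = 1" and eq: "{x. a \<bullet> x = b} = {x. a' \<bullet> x = b'}"
  shows "a' = a \<or> a' = - a"
proof -
  have aa: "a \<bullet> a = 1" using a by (simp add: dot_square_norm)
  define w where "w = perp a a'"
  have aw: "a \<bullet> w = 0" by (simp add: w_def perp_unit[OF a(1)])
  have "b *\<^sub>R a \<in> {x. a \<bullet> x = b}" "b *\<^sub>R a + w \<in> {x. a \<bullet> x = b}" by (simp_all add: aa aw inner_add_right)
  then have "a' \<bullet> w = 0" unfolding eq by (simp add: inner_add_right)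
  moreover have "w \<bullet> w = a' \<bullet> w - (a \<bullet> a') * (a \<bullet> w)" by (simp add: w_def perp_def inner_diff_left)
  ultimately have "w = 0" using aw by simp
  then have a': "a' = (a \<bullet> a') *\<^sub>R a" by (simp add: w_def perp_def)
  then have "\<bar>a \<bullet> a'\<bar> = 1" using a by (metis mult.right_neutral norm_scaleR)
  then have "a \<bullet> a' = 1 \<or> a \<bullet> a' = - 1" by linarith
  then show ?thesis using a' by (metis scaleR_minus1_left scaleR_one)
qed

lemma flat_tangent_cone_normal:
  assumes "flat_tangent_cone X p"
  shows "\<exists>N. norm N = 1 \<and> tangent_cone X p = {x. N \<bullet> x = N \<bullet> p}"
proof -
  obtain N b where N: "norm N = 1" "tangent_cone X p = {x. N \<bullet> x = b}"
    using assms by (auto simp: flat_tangent_cone_def hyperplanes_def hyperplane_params_def hyperplane_of_def)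
  then have "N \<bullet> p = b" using assms by (auto simp: flat_tangent_cone_def)
  then show ?thesis using N by blast
qed

lemma inner_sgn: "x \<bullet> sgn y = (x \<bullet> y) / norm y" for x y :: "'a::real_inner"
  by (simp add: sgn_div_norm divide_inverse mult.commute)

text \<open>Otherwise the unit directions of a violating sequence accumulate, by compactness of the
  sphere, at a tangent direction that is not orthogonal to \<open>N\<close>.\<close>

lemma tangent_cone_near:
  fixes X :: "'a::euclidean_space set"
  assumes T: "tangent_cone X q \<subseteq> {x. N \<bullet> x = N \<bullet> q}" and e: "0 < e"
  shows "\<exists>d>0. \<forall>x\<in>X. dist x q < d \<longrightarrow> \<bar>N \<bullet> (x - q)\<bar> \<le> e * norm (x - q)"
proof (rule ccontr)
  assume no: "\<not> ?thesis"
  have "\<exists>x\<in>X. dist x q < inverse (real (Suc i)) \<and> e * norm (x - q) < \<bar>N \<bullet> (x - q)\<bar>" for i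
  proof -
    have "0 < inverse (real (Suc i))" by simp
    then show ?thesis using no by (meson not_le)
  qed
  then obtain s where s: "\<And>i. s i \<in> X" "\<And>i. dist (s i) q < inverse (real (Suc i))"
    "\<And>i. e * norm (s i - q) < \<bar>N \<bullet> (s i - q)\<bar>" by metis
  have sq: "s i \<noteq> q" for i using s(3)[of i] by auto
  have lim: "s \<longlonglongrightarrow> q"
    by (rule metric_tendsto_imp_tendsto[OF LIMSEQ_inverse_real_of_nat]) (use s(2) in \<open>auto simp: less_imp_le\<close>)
  have "\<And>i. sgn (s i - q) \<in> sphere 0 1" using sq by (simp add: norm_sgn)
  then obtain u \<phi> where u: "u \<in> sphere 0 1" "strict_mono (\<phi> :: nat \<Rightarrow> nat)" "((\<lambda>i. sgn (s i - q)) \<circ> \<phi>) \<longlonglongrightarrow> u"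
    using compact_sphere[of "0 :: 'a" 1] unfolding compact_def by meson
  have "q + 1 *\<^sub>R u \<in> ray q u" unfolding ray_def by (intro CollectI exI[of _ 1]) auto
  moreover have "ray q u \<subseteq> tangent_cone X q"
    unfolding tangent_cone_def
  proof (intro Union_upper CollectI exI[of _ u] conjI refl)
    show "norm u = 1" using u(1) by simp
    show "\<exists>s. (\<forall>i. s i \<in> X - {q}) \<and> s \<longlonglongrightarrow> q \<and> (\<lambda>i. sgn (s i - q)) \<longlonglongrightarrow> u"
      using s(1) sq LIMSEQ_subseq_LIMSEQ[OF lim u(2)] u(3) by (intro exI[of _ "s \<circ> \<phi>"]) (auto simp: o_def)
  qed
  ultimately have "N \<bullet> u = 0" using T by (auto simp: inner_add_right)
  have "e \<le> \<bar>N \<bullet> sgn (s i - q)\<bar>" for i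
    using s(3)[of i] sq[of i] inner_sgn[of N "s i - q"] by (simp add: abs_divide pos_le_divide_eq)
  then have "\<And>i. e \<le> \<bar>N \<bullet> ((\<lambda>i. sgn (s i - q)) \<circ> \<phi>) i\<bar>" by simp
  moreover have "(\<lambda>i. \<bar>N \<bullet> ((\<lambda>i. sgn (s i - q)) \<circ> \<phi>) i\<bar>) \<longlonglongrightarrow> \<bar>N \<bullet> u\<bar>"
    by (intro tendsto_intros u(3))
  ultimately have "e \<le> \<bar>N \<bullet> u\<bar>" by (meson LIMSEQ_le_const)
  then show False using \<open>N \<bullet> u = 0\<close> e by simp
qed

text \<open>Two rays from \<open>q\<close> that share a point other than \<open>q\<close> have the same direction, so the sequence
  witnessing membership of \<open>q + u\<close> has limit direction \<open>u\<close>.\<close>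

lemma tangent_cone_dirs:
  fixes X :: "'a::real_normed_vector set"
  assumes u: "norm u = 1" and qu: "q + u \<in> tangent_cone X q" and ed: "0 < e" "0 < d"
  shows "\<exists>x\<in>X. 0 < dist x q \<and> dist x q < d \<and> norm (sgn (x - q) - u) < e"
proof -
  obtain u' where u': "q + u \<in> ray q u'" "norm u' = 1" and
      ex: "\<exists>s :: nat \<Rightarrow> 'a. (\<forall>i. s i \<in> X - {q}) \<and> s \<longlonglongrightarrow> q \<and> (\<lambda>i. sgn (s i - q)) \<longlonglongrightarrow> u'"
    using qu unfolding tangent_cone_def by blast
  obtain s :: "nat \<Rightarrow> 'a" where s: "\<And>i. s i \<in> X - {q}" "s \<longlonglongrightarrow> q" "(\<lambda>i. sgn (s i - q)) \<longlonglongrightarrow> u'"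
    using ex by blast
  obtain t where "q + u = q + t *\<^sub>R u'" "0 \<le> t" using u'(1) by (auto simp: ray_def)
  then have ut: "u = t *\<^sub>R u'" "0 \<le> t" by simp_all
  then have "t = 1" using u'(2) u by simp
  then have "u = u'" using ut by simp
  then have "\<forall>\<^sub>F i in sequentially. dist (s i) q < d \<and> dist (sgn (s i - q)) u < e"
    using tendstoD[OF s(2) ed(2)] tendstoD[OF s(3) ed(1)] by (simp add: eventually_conj)
  from eventually_happens'[OF sequentially_bot this]
  obtain i where "dist (s i) q < d" "dist (sgn (s i - q)) u < e" by blast
  then show ?thesis using s(1)[of i] by (intro bexI[of _ "s i"]) (auto simp: dist_norm)
qed

text \<open>The hyperplanes whose unit normals are within \<open>e\<close> of \<open>\<plusminus> \<nu> q\<close> form an open set of the quotient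
  topology, because the open set of parameters that describes them is closed under change of sign
  and therefore a full preimage.\<close>

lemma continuous_tangent_cones_normal:
  fixes X :: "'a::euclidean_space set"
  assumes ct: "continuous_tangent_cones X" and \<nu>: "\<And>p. p \<in> X \<Longrightarrow> norm (\<nu> p) = 1"
    "\<And>p. p \<in> X \<Longrightarrow> tangent_cone X p = {x. \<nu> p \<bullet> x = \<nu> p \<bullet> p}" and q: "q \<in> X" and e: "0 < e"
  shows "\<exists>d>0. \<forall>x\<in>X. dist x q < d \<longrightarrow> norm (\<nu> x - \<nu> q) < e \<or> norm (\<nu> x + \<nu> q) < e"
proof -
  let ?O = "{c :: 'a \<times> real. norm (fst c - \<nu> q) < e \<or> norm (fst c + \<nu> q) < e}"
  let ?W = "hyperplane_of ` (hyperplane_params \<inter> ?O)"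
  have same: "c' \<in> ?O" if c: "c \<in> hyperplane_params" "c' \<in> hyperplane_params" "c \<in> ?O"
    "hyperplane_of c = hyperplane_of c'" for c c'
  proof -
    have "fst c' = fst c \<or> fst c' = - fst c"
      using c by (intro hyperplane_normal_unique[of _ _ "snd c" "snd c'"])
        (auto simp: hyperplane_params_def hyperplane_of_def split: prod.splits)
    moreover have "norm (- fst c - \<nu> q) = norm (fst c + \<nu> q)" "norm (- fst c + \<nu> q) = norm (fst c - \<nu> q)"
      using norm_minus_cancel[of "fst c + \<nu> q"] norm_minus_commute[of "fst c" "\<nu> q"] by simp_all
    ultimately show ?thesis using c(3) by auto
  qed
  have "open ?O" by (intro open_Collect_disj open_Collect_less continuous_intros)
  moreover have "{c \<in> hyperplane_params. hyperplane_of c \<in> ?W} = hyperplane_params \<inter> ?O"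
  proof (intro equalityI subsetI)
    fix c assume "c \<in> {c \<in> hyperplane_params. hyperplane_of c \<in> ?W}"
    then obtain c' where "c \<in> hyperplane_params" "c' \<in> hyperplane_params" "c' \<in> ?O"
      "hyperplane_of c = hyperplane_of c'" by blast
    then show "c \<in> hyperplane_params \<inter> ?O" using same[of c' c] by blast
  qed blast
  ultimately have W: "openin hyperplane_topology ?W"
    by (auto simp: openin_hyperplane_topology hyperplanes_def openin_open_Int)
  define S where "S = {x \<in> X. tangent_cone X x \<in> ?W}"
  have op: "openin (top_of_set X) S" unfolding S_def
    using openin_continuous_map_preimage[OF ct[unfolded continuous_tangent_cones_def] W] by simp
  have par: "(\<nu> x, \<nu> x \<bullet> x) \<in> hyperplane_params" "tangent_cone X x = hyperplane_of (\<nu> x, \<nu> x \<bullet> x)"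
    if "x \<in> X" for x using \<nu>[OF that] by (auto simp: hyperplane_params_def hyperplane_of_def)
  have "(\<nu> q, \<nu> q \<bullet> q) \<in> hyperplane_params \<inter> ?O" using par(1)[OF q] e by simp
  then have "q \<in> S" unfolding S_def using q par(2)[OF q] by (intro CollectI conjI) (auto intro: imageI)
  then obtain d where d0: "0 < d" "\<And>x. x \<in> X \<Longrightarrow> dist x q < d \<Longrightarrow> x \<in> S"
    using op unfolding openin_euclidean_subtopology_iff by meson
  have d: "0 < d" "\<And>x. x \<in> X \<Longrightarrow> dist x q < d \<Longrightarrow> tangent_cone X x \<in> ?W"
    using d0 unfolding S_def by blast+
  have "norm (\<nu> x - \<nu> q) < e \<or> norm (\<nu> x + \<nu> q) < e" if x: "x \<in> X" "dist x q < d" for x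
  proof -
    obtain c where "c \<in> hyperplane_params" "c \<in> ?O" "hyperplane_of c = hyperplane_of (\<nu> x, \<nu> x \<bullet> x)"
      using d(2)[OF x] par(2)[OF x(1)] by auto
    then have "(\<nu> x, \<nu> x \<bullet> x) \<in> ?O" using same par(1)[OF x(1)] by blast
    then show ?thesis by simp
  qed
  then show ?thesis using d(1) by blast
qed

lemma tangent_field_exists:
  fixes X :: "'a::euclidean_space set"
  assumes "loc_closed X" "\<And>p. p \<in> X \<Longrightarrow> flat_tangent_cone X p" "continuous_tangent_cones X"
  shows "\<exists>\<nu>. tangent_field X \<nu>"
proof -
  have "\<forall>p\<in>X. \<exists>N. norm N = 1 \<and> tangent_cone X p = {x. N \<bullet> x = N \<bullet> p}"
    by (intro ballI flat_tangent_cone_normal assms(2))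
  then obtain \<nu> where \<nu>: "\<And>p. p \<in> X \<Longrightarrow> norm (\<nu> p) = 1"
    "\<And>p. p \<in> X \<Longrightarrow> tangent_cone X p = {x. \<nu> p \<bullet> x = \<nu> p \<bullet> p}" by metis
  have "tangent_field X \<nu>"
  proof
    show "\<exists>\<rho>>0. compact (X \<inter> cball p \<rho>)" if "p \<in> X" for p
      using loc_closed_imp_locally_compact[OF assms(1) that] .
    show "norm (\<nu> q) = 1" if "q \<in> X" for q by (rule \<nu>(1)[OF that])
    show "\<exists>d>0. \<forall>x\<in>X. dist x q < d \<longrightarrow> \<bar>\<nu> q \<bullet> (x - q)\<bar> \<le> e * norm (x - q)"
      if "q \<in> X" "0 < e" for q e
      using that(2) by (intro tangent_cone_near) (simp_all add: \<nu>(2)[OF that(1)])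
    show "\<exists>x\<in>X. 0 < dist x q \<and> dist x q < d \<and> norm (sgn (x - q) - u) < e"
      if "q \<in> X" "norm u = 1" "\<nu> q \<bullet> u = 0" "0 < e" "0 < d" for q u e d
      using that by (intro tangent_cone_dirs) (simp_all add: \<nu>(2)[OF that(1)] inner_add_right)
    show "\<exists>d>0. \<forall>x\<in>X. dist x q < d \<longrightarrow> norm (\<nu> x - \<nu> q) < e \<or> norm (\<nu> x + \<nu> q) < e"
      if "q \<in> X" "0 < e" for q e
      by (rule continuous_tangent_cones_normal[OF assms(3) \<nu> that])
  qed
  then show ?thesis by (rule exI[of _ \<nu>])
qed

section \<open>Graphs as hypersurfaces\<close>

definition sheet :: "'a::real_vector \<Rightarrow> 'a \<Rightarrow> ('a \<Rightarrow> real) \<Rightarrow> 'a \<Rightarrow> 'a" where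
  "sheet p a f z = p + z + f z *\<^sub>R a"

lemma perp_sheet:
  assumes "norm a = 1" "a \<bullet> z = 0"
  shows "perp a (sheet p a f z - p) = z" "a \<bullet> (sheet p a f z - p) = f z"
  using assms by (simp_all add: sheet_def add_diff_eq perp_simps perp_unit perp_eq_self inner_add_right dot_square_norm)

text \<open>An orthogonal map \<open>Q\<close> with inverse \<open>R\<close> that turns \<open>a\<close> into the last coordinate direction, and
  hence \<open>a\<^sup>\<bottom>\<close> into the coordinate hyperplane over which graphs are required to live.\<close>

definition straightening :: "real ^ 'n \<Rightarrow> (real ^ 'n \<Rightarrow> real ^ 'n) \<Rightarrow> (real ^ 'n \<Rightarrow> real ^ 'n) \<Rightarrow> bool" where
  "straightening a Q R \<longleftrightarrow> orthogonal_transformation Q \<and> orthogonal_transformation R \<and>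
    Q a = axis last_index 1 \<and> (\<forall>x. Q (R x) = x) \<and> (\<forall>x. R (Q x) = x) \<and> (\<forall>x y. Q x \<bullet> y = x \<bullet> R y) \<and>
    (\<forall>x. Q x \<in> coord_hyperplane \<longleftrightarrow> a \<bullet> x = 0)"

lemma straighteningD:
  assumes "straightening a Q R"
  shows "orthogonal_transformation Q" "orthogonal_transformation R" "Q a = axis last_index 1"
    "Q (R x) = x" "R (Q x) = x" "Q x \<bullet> y = x \<bullet> R y" "Q x \<in> coord_hyperplane \<longleftrightarrow> a \<bullet> x = 0"
    "bounded_linear Q" "bounded_linear R" "norm (Q x) = norm x" "norm (R x) = norm x"
proof -
  note * = assms[unfolded straightening_def]
  show o: "orthogonal_transformation Q" "orthogonal_transformation R" by (simp_all only: *)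
  show "Q a = axis last_index 1" by (simp only: *)
  show "Q (R x) = x" "R (Q x) = x" "Q x \<bullet> y = x \<bullet> R y" "Q x \<in> coord_hyperplane \<longleftrightarrow> a \<bullet> x = 0"
    by (simp_all only: *)
  show "bounded_linear Q" "bounded_linear R"
    using o[THEN orthogonal_transformation_linear] linear_conv_bounded_linear by blast+
  show "norm (Q x) = norm x" "norm (R x) = norm x" by (rule o[THEN orthogonal_transformation_norm])+
qed

lemma straightening_exists:
  fixes a :: "real ^ 'n"
  assumes "norm a = 1"
  shows "\<exists>Q R. straightening a Q R"
proof -
  obtain Q :: "real ^ 'n \<Rightarrow> real ^ 'n" where Q: "orthogonal_transformation Q" "Q a = axis last_index 1"
    by (rule orthogonal_transformation_exists[of a "axis last_index 1"]) (use assms in simp)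
  have QR: "\<And>x. Q (inv Q x) = x" "\<And>x. inv Q (Q x) = x"
    using orthogonal_transformation_bij[OF Q(1)] by (simp_all add: bij_is_surj bij_is_inj surj_f_inv_f)
  have ax: "Q x \<bullet> y = x \<bullet> inv Q y" for x y using Q(1) QR by (metis orthogonal_transformation_def)
  have "Q x $ last_index = a \<bullet> x" for x
  proof -
    have "Q x $ last_index = axis last_index 1 \<bullet> Q x" by (simp add: inner_axis inner_commute)
    also have "\<dots> = a \<bullet> x" using Q by (metis orthogonal_transformation_def)
    finally show ?thesis .
  qed
  then have coord: "Q x \<in> coord_hyperplane \<longleftrightarrow> a \<bullet> x = 0" for x by (simp add: coord_hyperplane_def)
  show ?thesis
    unfolding straightening_def
    by (intro exI[of _ Q] exI[of _ "inv Q"] conjI allI Q orthogonal_transformation_inv QR ax coord)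
qed

lemma sheet_homeomorphic:
  fixes a :: "real ^ 'n"
  assumes a: "norm a = 1" and f: "continuous_on (open_disc a r) f"
  shows "sheet p a f ` open_disc a r homeomorphic coord_hyperplane \<inter> ball (0 :: real ^ 'n) r"
proof -
  obtain Q R where "straightening a Q R" using straightening_exists[OF a] by blast
  note Q = straighteningD[OF this]
  have lin: "continuous_on S Q" "continuous_on S R" for S
    using Q(8,9) by (simp_all add: linear_continuous_on)
  have D: "z \<in> open_disc a r \<longleftrightarrow> Q z \<in> coord_hyperplane \<inter> ball 0 r" for z
    by (simp add: open_disc_def Q(7,10))
  have cp: "continuous_on S (\<lambda>x. Q (perp a (x - p)))" for S
    by (rule continuous_on_compose2[OF lin(1)[of UNIV]]) (auto intro!: continuous_intros)
  have cf: "continuous_on (coord_hyperplane \<inter> ball 0 r) (\<lambda>y. f (R y))"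
    by (rule continuous_on_compose2[OF f lin(2)]) (use D Q(4) in auto)
  have 1: "Q (perp a (sheet p a f z - p)) = Q z" if "z \<in> open_disc a r" for z
    using perp_sheet(1)[OF a] that by (simp add: open_disc_def)
  have DR: "R y \<in> open_disc a r" if "y \<in> coord_hyperplane \<inter> ball 0 r" for y
    using that by (simp only: D Q(4))
  show ?thesis unfolding homeomorphic_minimal
  proof (intro exI conjI ballI)
    show "continuous_on (sheet p a f ` open_disc a r) (\<lambda>x. Q (perp a (x - p)))" by (rule cp)
    show "continuous_on (coord_hyperplane \<inter> ball 0 r) (\<lambda>y. sheet p a f (R y))"
      unfolding sheet_def by (intro continuous_intros lin(2) cf)
    fix x assume "x \<in> sheet p a f ` open_disc a r"
    then obtain z where z: "z \<in> open_disc a r" "x = sheet p a f z" by blast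
    show "Q (perp a (x - p)) \<in> coord_hyperplane \<inter> ball 0 r" unfolding z(2) 1[OF z(1)] using D z(1) by blast
    show "sheet p a f (R (Q (perp a (x - p)))) = x" unfolding z(2) 1[OF z(1)] Q(5) ..
  next
    fix y :: "real ^ 'n" assume y: "y \<in> coord_hyperplane \<inter> ball 0 r"
    show "sheet p a f (R y) \<in> sheet p a f ` open_disc a r" using DR[OF y] by (rule imageI)
    show "Q (perp a (sheet p a f (R y) - p)) = y" unfolding 1[OF DR[OF y]] Q(4) ..
  qed
qed

lemma C1_hypersurface_sheet:
  fixes a :: "real ^ 'n"
  assumes a: "norm a = 1" and g: "continuous_on (open_disc a r) g"
    and g0: "\<And>z. z \<in> open_disc a r \<Longrightarrow> a \<bullet> g z = 0"
    and f: "\<And>z. z \<in> open_disc a r \<Longrightarrow> (f has_derivative (\<lambda>h. g z \<bullet> h)) (at z within open_disc a r)"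
  shows "C1_hypersurface (sheet p a f ` open_disc a r)"
proof -
  let ?S = "sheet p a f ` open_disc a r" and ?V = "coord_hyperplane \<inter> ball (0 :: real ^ 'n) r"
  obtain Q R where "straightening a Q R" using straightening_exists[OF a] by blast
  note Q = straighteningD[OF this]
  have bl: "bounded_linear Q" "bounded_linear R"
    by (fact Q(8), fact Q(9))
  then have lin: "continuous_on S Q" "continuous_on S R" for S by (simp_all add: linear_continuous_on)
  have D: "z \<in> open_disc a r \<longleftrightarrow> Q z \<in> ?V" for z
    by (simp add: open_disc_def Q(7,10))
  have DR: "R y \<in> open_disc a r \<longleftrightarrow> y \<in> ?V" for y using D Q(4) by simp
  have RV: "R ` ?V = open_disc a r"
  proof (intro equalityI subsetI)
    fix z assume "z \<in> open_disc a r"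
    then show "z \<in> R ` ?V" using D by (intro image_eqI[of _ _ "Q z"]) (simp_all only: Q(5))
  qed (use DR in blast)
  have V: "openin (top_of_set coord_hyperplane) ?V" by (simp add: openin_open_Int)
  have cf: "continuous_on (open_disc a r) f"
    using f by (auto simp: continuous_on_eq_continuous_within intro: has_derivative_continuous)
  have hyp: "hypersurface ?S"
    unfolding hypersurface_def using V sheet_homeomorphic[OF a cf, of p]
    by (intro ballI exI[of _ ?S] exI[of _ ?V]) auto
  have C1: "C1_fun_on ?V (\<lambda>y. f (R y))"
    unfolding C1_fun_on_def
  proof (intro exI[of _ "\<lambda>y. Q (g (R y))"] conjI ballI)
    have "continuous_on ?V (\<lambda>y. g (R y))"
      by (rule continuous_on_compose2[OF g lin(2)]) (simp only: RV order_refl)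
    then show "continuous_on ?V (\<lambda>y. Q (g (R y)))"
      by (rule continuous_on_compose2[OF lin(1)[of UNIV] _ subset_UNIV])
    fix y assume y: "y \<in> ?V"
    then have yD: "R y \<in> open_disc a r" by (simp only: DR)
    show "Q (g (R y)) \<in> coord_hyperplane" using g0[OF yD] by (simp only: Q(7))
    have "(f has_derivative (\<lambda>h. g (R y) \<bullet> h)) (at (R y) within R ` ?V)"
      unfolding RV by (rule f[OF yD])
    then have "((f \<circ> R) has_derivative ((\<lambda>h. g (R y) \<bullet> h) \<circ> R)) (at y within ?V)"
      by (rule diff_chain_within[OF bounded_linear_imp_has_derivative[OF bl(2)]])
    then show "((\<lambda>y. f (R y)) has_derivative (\<lambda>h. Q (g (R y)) \<bullet> h)) (at y within ?V)"
      by (simp only: o_def Q(6))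
  qed
  define \<Phi> where "\<Phi> x = - Q p + Q x" for x
  have rm: "rigid_motion \<Phi>" unfolding rigid_motion_def
    by (intro exI[of _ "- Q p"] exI[of _ Q] conjI Q(1)) (simp add: \<Phi>_def fun_eq_iff)
  have ax: "axis last_index c = c *\<^sub>R axis (last_index :: 'n) (1 :: real)" for c
    by (simp add: vec_eq_iff axis_def)
  have \<Phi>: "\<Phi> (sheet p a f z) = Q z + axis last_index (f z)" for z
  proof -
    note l = bounded_linear.linear[OF bl(1)]
    have "Q (sheet p a f z) = Q p + Q z + f z *\<^sub>R Q a"
      by (simp only: sheet_def linear_add[OF l] linear_scale[OF l])
    then show ?thesis unfolding \<Phi>_def Q(3) ax[of "f z"] by simp
  qed
  have "\<Phi> ` ?S = graph_over ?V (\<lambda>y. f (R y))"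
  proof -
    have "\<Phi> ` ?S = (\<lambda>z. Q z + axis last_index (f z)) ` R ` ?V" unfolding RV image_image \<Phi> ..
    then show ?thesis by (simp only: graph_over_def image_image Q(4))
  qed
  then have im: "\<Phi> ` (?S \<inter> UNIV) = graph_over ?V (\<lambda>y. f (R y))" by (simp only: Int_UNIV_right)
  show ?thesis unfolding C1_hypersurface_def
    by (intro conjI hyp ballI exI[of _ UNIV] exI[of _ \<Phi>] exI[of _ ?V] exI[of _ "\<lambda>y. f (R y)"]
        rm V C1 im open_UNIV UNIV_I)
qed

section \<open>Density where two sheets separate\<close>

lemma open_disc_minus: "open_disc (- a) r = open_disc a r"
  by (simp add: open_disc_def)

lemma has_derivative_local_Lipschitz:
  fixes g :: "'a::real_inner"
  assumes f: "(f has_derivative (\<lambda>h. g \<bullet> h)) (at z within D)" and g: "norm g \<le> \<epsilon>" and \<epsilon>: "0 < \<epsilon>"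
  shows "\<exists>d>0. \<forall>z'\<in>D. norm (z' - z) < d \<longrightarrow> \<bar>f z' - f z\<bar> \<le> 2 * \<epsilon> * norm (z' - z)"
proof -
  obtain d where d: "0 < d"
    "\<And>z'. z' \<in> D \<Longrightarrow> norm (z' - z) < d \<Longrightarrow> \<bar>f z' - f z - g \<bullet> (z' - z)\<bar> \<le> \<epsilon> * norm (z' - z)"
    using f \<epsilon> unfolding has_derivative_within_alt real_norm_def by meson
  have "\<bar>f z' - f z\<bar> \<le> 2 * \<epsilon> * norm (z' - z)" if z': "z' \<in> D" "norm (z' - z) < d" for z'
  proof -
    have "\<bar>g \<bullet> (z' - z)\<bar> \<le> norm g * norm (z' - z)" by (rule Cauchy_Schwarz_ineq2)
    also have "\<dots> \<le> \<epsilon> * norm (z' - z)" using g by (rule mult_right_mono) simp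
    finally have "\<bar>f z' - f z\<bar> \<le> \<epsilon> * norm (z' - z) + \<epsilon> * norm (z' - z)" using d(2)[OF z'] by linarith
    then show ?thesis by simp
  qed
  then show ?thesis using d(1) by blast
qed

text \<open>Over the centre of a flat cylinder the fibre consists of \<open>p\<close> alone, so the top sheet passes
  through \<open>p\<close>.\<close>

lemma C1_hypersurface_through:
  fixes X :: "(real ^ 'n) set"
  assumes tf: "tangent_field X \<nu>" and p: "p \<in> X"
  shows "\<exists>S. C1_hypersurface S \<and> p \<in> S \<and> S \<subseteq> X"
proof -
  interpret tangent_field X \<nu> by (rule tf)
  define a where "a = \<nu> p"
  have a: "norm a = 1" unfolding a_def by (rule unit[OF p])
  obtain r where r: "flat_cyl 1 a p r" using flat_cyl_exists[OF p, of 1] unfolding a_def by auto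
  obtain f g where fg: "is_top_sheet 1 a p r f g" using top_sheet_exists[OF _ _ r] by auto
  have "0 < r" using r by (simp add: flat_cyl_def)
  then have 0: "0 \<in> open_disc a r" by (simp add: open_disc_def)
  have "C1_hypersurface (sheet p a f ` open_disc a r)"
    by (rule C1_hypersurface_sheet[OF a, where g = g]) (use fg in \<open>simp_all add: is_top_sheet_def\<close>)
  moreover have "f 0 = 0" using fg 0 unfolding is_top_sheet_def by fastforce
  then have "p \<in> sheet p a f ` open_disc a r" using 0 by (intro image_eqI[of _ _ 0]) (simp_all add: sheet_def)
  moreover have "sheet p a f ` open_disc a r \<subseteq> X"
    using fg by (auto simp: is_top_sheet_def sheet_def cyl_def)
  ultimately show ?thesis by blast
qed

text \<open>The lower density forced by two sheets of slope at most \<open>\<epsilon>\<close> that agree at a point and separate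
  over one side of it; it tends to \<open>3 / 2\<close> as \<open>\<epsilon> \<rightarrow> 0\<close>.\<close>

definition split_density :: "nat \<Rightarrow> real \<Rightarrow> real" where
  "split_density k \<epsilon> = (1 / (1 + 2 * \<epsilon>)) ^ k * (1 + (1 - \<epsilon>) ^ k / 2)"

text \<open>The top and bottom sheets agree over the centre.  If they differ at \<open>x1\<close>, then the largest
  open disc about \<open>x1\<close> over which they differ has a boundary point \<open>x0\<close> over which they agree.  Near
  the common point \<open>q\<close> over \<open>x0\<close>, the set \<open>X\<close> contains the whole bottom sheet and, disjoint from it, the top
  sheet over that disc, which near \<open>x0\<close> fills almost a half disc.  So the density at \<open>q\<close> is almost \<open>3 / 2\<close>
  at least.  Passing to the boundary of a disc, rather than to an arbitrary boundary point of the
  region of separation, is what guarantees the half disc.\<close>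

lemma split_sheets_density:
  fixes X :: "(real ^ 'n) set"
  assumes tf: "tangent_field X \<nu>" and \<epsilon>: "0 < \<epsilon>" "\<epsilon> < 1" and a: "norm a = 1"
    and hi: "tangent_field.is_top_sheet X \<epsilon> a p r hi ghi"
    and lo': "tangent_field.is_top_sheet X \<epsilon> (- a) p r lo' glo"
    and x1: "a \<bullet> x1 = 0" "2 * norm x1 < r" "hi x1 \<noteq> - lo' x1"
  shows "\<exists>q\<in>X. ennreal (split_density (CARD('n) - 1) \<epsilon>) \<le> tangent_multiplicity X q"
proof -
  interpret tangent_field X \<nu> by (rule tf)
  let ?D = "open_disc a r"
  define lo where "lo z = - lo' z" for z
  have D: "z \<in> ?D \<longleftrightarrow> a \<bullet> z = 0 \<and> norm z < r" for z by (simp add: open_disc_def)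
  have H: "p + z + hi z *\<^sub>R a \<in> cyl a p r" "\<bar>hi z\<bar> \<le> \<epsilon> * norm z" "norm (ghi z) \<le> \<epsilon>"
      "(hi has_derivative (\<lambda>h. ghi z \<bullet> h)) (at z within ?D)" if "z \<in> ?D" for z
    using hi that unfolding is_top_sheet_def by blast+
  have ch: "continuous_on ?D hi" using hi unfolding is_top_sheet_def by blast
  have L: "p + z + lo z *\<^sub>R a \<in> cyl a p r" "\<bar>lo z\<bar> \<le> \<epsilon> * norm z" "norm (- glo z) \<le> \<epsilon>"
      "(lo has_derivative (\<lambda>h. - glo z \<bullet> h)) (at z within ?D)" if "z \<in> ?D" for z
    using lo' that unfolding is_top_sheet_def open_disc_minus cyl_minus lo_def
    by (auto intro!: has_derivative_minus)
  have cl: "continuous_on ?D lo" unfolding lo_def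
    using lo' unfolding is_top_sheet_def open_disc_minus by (intro continuous_intros) blast
  have X: "sheet p a hi z \<in> X" "sheet p a lo z \<in> X" if "z \<in> ?D" for z
    using H(1)[OF that] L(1)[OF that] by (simp_all add: sheet_def cyl_def)
  have r: "0 < r" using x1(2) norm_ge_zero[of x1] by linarith
  \<comment> \<open>\<open>C\<close> lies in the base and contains the disc about \<open>x1\<close> that reaches to the centre\<close>
  define C where "C = {z. a \<bullet> z = 0 \<and> norm z \<le> 2 * norm x1}"
  have CD: "C \<subseteq> ?D" using x1 by (auto simp: C_def D)
  have "C = cball 0 (2 * norm x1) \<inter> {z. a \<bullet> z = 0}" by (auto simp: C_def)
  then have cC: "compact C" by (simp add: compact_Int_closed closed_hyperplane)
  define Z where "Z = {z \<in> C. hi z = lo z}"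
  have cZ: "compact Z"
  proof -
    have "continuous_on C (\<lambda>z. hi z - lo z)"
      using continuous_on_subset[OF ch CD] continuous_on_subset[OF cl CD] by (intro continuous_intros)
    then have "closed (C \<inter> (\<lambda>z. hi z - lo z) -` {0})"
      using compact_imp_closed[OF cC] by (intro continuous_closed_preimage) auto
    moreover have "Z = C \<inter> (C \<inter> (\<lambda>z. hi z - lo z) -` {0})" by (auto simp: Z_def)
    ultimately show ?thesis using compact_Int_closed[OF cC] by metis
  qed
  have "0 \<in> ?D" using r by (simp add: D)
  then have "hi 0 = 0" "lo 0 = 0" using H(2)[of 0] L(2)[of 0] by auto
  then have Z0: "0 \<in> Z" by (simp add: Z_def C_def)
  have "continuous_on Z (\<lambda>z. norm (z - x1))" by (intro continuous_intros)
  then obtain x0 where x0: "x0 \<in> Z" "\<And>z. z \<in> Z \<Longrightarrow> norm (x0 - x1) \<le> norm (z - x1)"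
    using continuous_attains_inf[OF cZ] Z0 by blast
  define R where "R = norm (x0 - x1)"
  have R1: "R \<le> norm x1" using x0(2)[OF Z0] by (simp add: R_def)
  have x0D: "x0 \<in> ?D" "a \<bullet> x0 = 0" "hi x0 = lo x0" using x0(1) CD by (auto simp: Z_def C_def)
  have R0: "0 < R" using x0D x1(3) by (auto simp: R_def lo_def)
  have apart: "hi z \<noteq> lo z" if "a \<bullet> z = 0" "norm (z - x1) < R" for z
  proof
    assume "hi z = lo z"
    moreover have "norm z \<le> 2 * norm x1" using that(2) R1 norm_triangle_sub[of z x1] by linarith
    ultimately have "z \<in> Z" using that(1) by (simp add: Z_def C_def)
    then show False using x0(2) that(2) unfolding R_def by force
  qed
  define v where "v = (1 / R) *\<^sub>R (x1 - x0)"
  have v: "norm v = 1" "a \<bullet> v = 0" and Rv: "x1 = x0 + R *\<^sub>R v"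
    using R0 x1(1) x0D(2) by (auto simp: v_def R_def norm_minus_commute inner_diff_right)
  define q where "q = sheet p a hi x0"
  have qX: "q \<in> X" unfolding q_def by (rule X(1)[OF x0D(1)])
  obtain d1 where d1: "0 < d1"
    "\<And>z. z \<in> ?D \<Longrightarrow> norm (z - x0) < d1 \<Longrightarrow> \<bar>hi z - hi x0\<bar> \<le> 2 * \<epsilon> * norm (z - x0)"
    using has_derivative_local_Lipschitz[OF H(4)[OF x0D(1)] H(3)[OF x0D(1)] \<epsilon>(1)] by blast
  obtain d2 where d2: "0 < d2"
    "\<And>z. z \<in> ?D \<Longrightarrow> norm (z - x0) < d2 \<Longrightarrow> \<bar>lo z - lo x0\<bar> \<le> 2 * \<epsilon> * norm (z - x0)"
    using has_derivative_local_Lipschitz[OF L(4)[OF x0D(1)] L(3)[OF x0D(1)] \<epsilon>(1)] by blast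
  \<comment> \<open>below \<open>r - norm x0\<close> the discs stay in the base, and below \<open>2 * R * \<epsilon>\<close> the cap stays in the disc of radius \<open>R\<close> about \<open>x1\<close>\<close>
  define b where "b = min (min d1 d2) (min (r - norm x0) (2 * R * \<epsilon>))"
  have b: "0 < b" "b \<le> d1" "b \<le> d2" "b \<le> r - norm x0" "b \<le> 2 * R * \<epsilon>"
    using d1 d2 x0D(1) R0 \<epsilon> by (auto simp: b_def D)
  obtain Q T where "straightening a Q T" using straightening_exists[OF a] by blast
  note Q = straighteningD[OF this]
  have lQ: "linear Q" using Q(8) by (rule bounded_linear.linear)
  have ratio: "ennreal (split_density (CARD('n) - 1) \<epsilon>) \<le>
      hausdorff_measure (CARD('n) - 1) (X \<inter> cball q \<rho>) /
      hausdorff_measure (CARD('n) - 1) (coord_hyperplane \<inter> cball (0 :: real ^ 'n) \<rho>)"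
    if \<rho>: "0 < \<rho>" "\<rho> < b" for \<rho>
  proof -
    \<comment> \<open>sheets with Lipschitz constant \<open>2 * \<epsilon>\<close> over a disc of radius \<open>s\<close> stay within distance \<open>\<rho>\<close> of \<open>q\<close>\<close>
    define s where "s = \<rho> / (1 + 2 * \<epsilon>)"
    have s: "0 < s" "s * (1 + 2 * \<epsilon>) = \<rho>" using \<rho> \<epsilon> by (auto simp: s_def)
    have "s \<le> s * (1 + 2 * \<epsilon>)" using s(1) \<epsilon> by simp
    then have sb: "s < b" using s(2) \<rho> by linarith
    define A0 where "A0 = {z. a \<bullet> z = 0 \<and> norm (z - x0) \<le> s}"
    define B0 where "B0 = {z \<in> A0. s * \<epsilon> \<le> v \<bullet> (z - x0)}"
    have A0D: "z \<in> ?D" if "z \<in> A0" for z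
      using that sb b(4) norm_triangle_sub[of z x0] by (auto simp: A0_def D)
    have BA: "B0 \<subseteq> A0" by (auto simp: B0_def)
    have "A0 = cball x0 s \<inter> {z. a \<bullet> z = 0}" by (auto simp: A0_def dist_norm norm_minus_commute)
    then have cA0: "compact A0" by (simp add: compact_Int_closed closed_hyperplane)
    have "closed {z. s * \<epsilon> \<le> v \<bullet> (z - x0)}" by (intro closed_Collect_le continuous_intros)
    moreover have "B0 = A0 \<inter> {z. s * \<epsilon> \<le> v \<bullet> (z - x0)}" by (auto simp: B0_def)
    ultimately have cB0: "compact B0" using compact_Int_closed[OF cA0] by metis
    have cs: "continuous_on S (sheet p a f)" if "continuous_on S f" for S f
      unfolding sheet_def using that by (intro continuous_intros)
    have sub: "A0 \<subseteq> ?D" "B0 \<subseteq> ?D" using A0D BA by blast+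
    define A where "A = sheet p a lo ` A0"
    define B where "B = sheet p a hi ` B0"
    have cA: "compact A" unfolding A_def
      by (intro compact_continuous_image cs continuous_on_subset[OF cl sub(1)] cA0)
    have cB: "compact B" unfolding B_def
      by (intro compact_continuous_image cs continuous_on_subset[OF ch sub(2)] cB0)
    have inball: "sheet p a f z \<in> cball q \<rho>" if z: "z \<in> A0" and f: "\<bar>f z - hi x0\<bar> \<le> 2 * \<epsilon> * norm (z - x0)" for f z
    proof -
      have "sheet p a f z - q = (z - x0) + (f z - hi x0) *\<^sub>R a"
        by (simp add: q_def sheet_def algebra_simps)
      then have "norm (sheet p a f z - q) \<le> norm (z - x0) + \<bar>f z - hi x0\<bar>"
        using norm_triangle_ineq[of "z - x0" "(f z - hi x0) *\<^sub>R a"] a by simp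
      also have "\<dots> \<le> norm (z - x0) + 2 * \<epsilon> * norm (z - x0)" using f by simp
      also have "\<dots> = norm (z - x0) * (1 + 2 * \<epsilon>)" by (simp add: algebra_simps)
      also have "\<dots> \<le> s * (1 + 2 * \<epsilon>)" using z \<epsilon> by (intro mult_right_mono) (auto simp: A0_def)
      finally show ?thesis using s(2) by (simp add: dist_norm norm_minus_commute)
    qed
    have As: "norm (z - x0) < d1" "norm (z - x0) < d2" if "z \<in> A0" for z
      using that sb b by (auto simp: A0_def)
    have ABX: "A \<union> B \<subseteq> X \<inter> cball q \<rho>"
    proof (intro Un_least Int_greatest)
      show "A \<subseteq> X" "B \<subseteq> X" using X sub by (auto simp: A_def B_def)
      show "A \<subseteq> cball q \<rho>" unfolding A_def
        using d2(2) As A0D x0D(3) by (intro image_subsetI inball) simp_all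
      show "B \<subseteq> cball q \<rho>" unfolding B_def
        using d1(2) As A0D BA by (intro image_subsetI inball) auto
    qed
    have disj: "A \<inter> B = {}"
    proof (rule ccontr)
      assume "A \<inter> B \<noteq> {}"
      then obtain z z' where z: "z \<in> A0" "z' \<in> B0" "sheet p a lo z = sheet p a hi z'"
        by (auto simp: A_def B_def)
      have az: "a \<bullet> z = 0" "a \<bullet> z' = 0" using z BA by (auto simp: A0_def)
      have zz: "z = z'" using perp_sheet(1)[OF a az(1), of p lo] perp_sheet(1)[OF a az(2), of p hi] z(3) by simp
      have "lo z = hi z" using perp_sheet(2)[OF a az(1), of p lo] perp_sheet(2)[OF a az(2), of p hi] z(3) zz by simp
      define y where "y = z - x0"
      have y: "norm y \<le> s" "s * \<epsilon> \<le> v \<bullet> y" using z zz by (auto simp: A0_def B0_def y_def)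
      have "z - x1 = y - R *\<^sub>R v" using Rv by (simp add: y_def)
      then have "(norm (z - x1))\<^sup>2 = (norm y)\<^sup>2 - 2 * (R * (v \<bullet> y)) + R\<^sup>2 * (norm v)\<^sup>2"
        unfolding power2_norm_eq_inner
        by (simp add: inner_diff_left inner_diff_right inner_commute power2_eq_square)
      also have "\<dots> = (norm y)\<^sup>2 - 2 * (R * (v \<bullet> y)) + R\<^sup>2" by (simp add: v(1))
      also have "\<dots> < R\<^sup>2"
      proof -
        have "(norm y)\<^sup>2 \<le> s\<^sup>2" using y(1) by (intro power_mono) auto
        also have "\<dots> < s * (2 * R * \<epsilon>)"
          unfolding power2_eq_square using s(1) sb b(5) by (intro mult_strict_left_mono) auto
        also have "\<dots> = 2 * (R * (s * \<epsilon>))" by simp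
        also have "\<dots> \<le> 2 * (R * (v \<bullet> y))" using y(2) R0 by (intro mult_left_mono) auto
        finally show ?thesis by simp
      qed
      finally have "norm (z - x1) < R" using R0 power2_less_imp_less[of "norm (z - x1)" R] by simp
      then show False using apart[OF az(1)] \<open>lo z = hi z\<close> by simp
    qed
    define G where "G x = (1 / s) *\<^sub>R Q (perp a (x - p) - x0)" for x
    have Glip: "dist (G x) (G y) \<le> (1 / s) * dist x y" for x y
    proof -
      have "G x - G y = (1 / s) *\<^sub>R Q (perp a (x - y))"
        unfolding G_def scaleR_diff_right[symmetric] linear_diff[OF lQ, symmetric] by (simp add: perp_simps)
      then show ?thesis using perp_unit(3)[OF a, of "x - y"] s(1) Q(10)
        by (simp add: dist_norm divide_right_mono)
    qed
    have Gs: "G (sheet p a f (x0 + s *\<^sub>R T w)) = w" if "w \<in> coord_hyperplane" for f w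
    proof -
      have "a \<bullet> T w = 0" using that Q(4,7) by metis
      then have "a \<bullet> (x0 + s *\<^sub>R T w) = 0" using x0D(2) by (simp add: inner_add_right)
      then have "G (sheet p a f (x0 + s *\<^sub>R T w)) = (1 / s) *\<^sub>R Q (s *\<^sub>R T w)"
        by (simp add: G_def perp_sheet(1)[OF a])
      then show ?thesis using s(1) by (simp add: linear_scale[OF lQ] Q(4))
    qed
    have inA0: "x0 + s *\<^sub>R T w \<in> A0" if "w \<in> coord_hyperplane" "norm w \<le> 1" for w
    proof -
      have "a \<bullet> T w = 0" using that(1) Q(4,7) by metis
      then show ?thesis using that(2) s(1) x0D(2) Q(11)
        by (simp add: A0_def inner_add_right mult_left_le)
    qed
    have covA: "coord_hyperplane \<inter> cball 0 1 \<subseteq> G ` A"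
    proof
      fix w :: "real ^ 'n" assume w: "w \<in> coord_hyperplane \<inter> cball 0 1"
      then have "sheet p a lo (x0 + s *\<^sub>R T w) \<in> A" unfolding A_def by (intro imageI inA0) auto
      then have "G (sheet p a lo (x0 + s *\<^sub>R T w)) \<in> G ` A" by (rule imageI)
      then show "w \<in> G ` A" using Gs[of w lo] w by simp
    qed
    have covB: "cap (Q v) \<epsilon> \<subseteq> G ` B"
    proof
      fix w assume "w \<in> cap (Q v) \<epsilon>"
      then have w: "w \<in> coord_hyperplane" "norm w \<le> 1" "\<epsilon> \<le> v \<bullet> T w"
        by (auto simp: cap_def Q(6))
      then have "x0 + s *\<^sub>R T w \<in> B0" using inA0 s(1) by (simp add: B0_def)
      then have "sheet p a hi (x0 + s *\<^sub>R T w) \<in> B" unfolding B_def by (rule imageI)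
      then have "G (sheet p a hi (x0 + s *\<^sub>R T w)) \<in> G ` B" by (rule imageI)
      then show "w \<in> G ` B" unfolding Gs[OF w(1)] .
    qed
    have "Q v \<in> coord_hyperplane" "norm (Q v) = 1" using v Q(7,10) by simp_all
    note dens = two_sheets_density[OF \<epsilon> this s(1) \<rho>(1) Glip cA covA cB covB disj ABX]
    have "s / \<rho> = 1 / (1 + 2 * \<epsilon>)" using \<rho>(1) by (simp add: s_def)
    then show ?thesis using dens unfolding split_density_def by simp
  qed
  have "ennreal (split_density (CARD('n) - 1) \<epsilon>) \<le> tangent_multiplicity X q"
    unfolding tangent_multiplicity_def
  proof (rule Liminf_bounded)
    show "\<forall>\<^sub>F \<rho> in at_right 0. ennreal (split_density (CARD('n) - 1) \<epsilon>) \<le>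
      hausdorff_measure (CARD('n) - 1) (X \<inter> cball q \<rho>) /
      hausdorff_measure (CARD('n) - 1) (coord_hyperplane \<inter> cball (0 :: real ^ 'n) \<rho>)"
      unfolding eventually_at_right_field using b(1) ratio by (intro exI[of _ b]) auto
  qed
  then show ?thesis using qX by blast
qed

lemma split_density_large:
  assumes "m < (3 / 2 :: ennreal)"
  shows "\<exists>\<epsilon>. 0 < \<epsilon> \<and> \<epsilon> < 1 \<and> m < ennreal (split_density k \<epsilon>)"
proof -
  have "(3 / 2 :: ennreal) = ennreal (3 / 2)"
    using divide_ennreal[of 3 2] by simp
  then obtain m' where m': "m = ennreal m'" "0 \<le> m'" "m' < 3 / 2"
    using assms by (cases m) (auto simp: ennreal_less_iff)
  have "((\<lambda>\<epsilon>. split_density k \<epsilon>) \<longlongrightarrow> (1 / (1 + 2 * 0)) ^ k * (1 + (1 - 0) ^ k / 2)) (at_right 0)"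
    unfolding split_density_def by (intro tendsto_intros) auto
  then have "\<forall>\<^sub>F \<epsilon> in at_right 0. m' < split_density k \<epsilon>"
    using m'(3) by (intro order_tendstoD(1)) auto
  moreover have "\<forall>\<^sub>F \<epsilon> in at_right 0. \<epsilon> \<in> {0<..<1::real}" by (intro eventually_at_right_real) simp
  ultimately have "\<forall>\<^sub>F \<epsilon> in at_right 0. m' < split_density k \<epsilon> \<and> \<epsilon> \<in> {0<..<1}" by (rule eventually_conj)
  from eventually_happens'[OF _ this] obtain \<epsilon> where "m' < split_density k \<epsilon>" "0 < \<epsilon>" "\<epsilon> < 1"
    by (auto simp: trivial_limit_at_right_real)
  then show ?thesis using m' by (intro exI[of _ \<epsilon>]) (auto simp: ennreal_less_iff)
qed

text \<open>For \<open>\<epsilon>\<close> small the sheets cannot separate anywhere near the centre, so all of \<open>X\<close> in the smaller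
  cylinder lies between two equal functions.\<close>

lemma hypersurface_of_low_multiplicity:
  fixes X :: "(real ^ 'n) set"
  assumes tf: "tangent_field X \<nu>" and m: "m < (3 / 2 :: ennreal)"
    and mult: "\<And>q. q \<in> X \<Longrightarrow> tangent_multiplicity X q \<le> m"
  shows "hypersurface X"
  unfolding hypersurface_def
proof
  fix p assume p: "p \<in> X"
  interpret tangent_field X \<nu> by (rule tf)
  obtain \<epsilon> where \<epsilon>: "0 < \<epsilon>" "\<epsilon> < 1" "m < ennreal (split_density (CARD('n) - 1) \<epsilon>)"
    using split_density_large[OF m] by blast
  define a where "a = \<nu> p"
  have a: "norm a = 1" unfolding a_def by (rule unit[OF p])
  obtain r where fb: "flat_cyl \<epsilon> a p r" using flat_cyl_exists[OF p, of \<epsilon>] \<epsilon> unfolding a_def by auto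
  obtain hi ghi where hi: "is_top_sheet \<epsilon> a p r hi ghi" using top_sheet_exists[OF _ _ fb] \<epsilon> by auto
  obtain lo glo where lo: "is_top_sheet \<epsilon> (- a) p r lo glo"
    using top_sheet_exists[of \<epsilon> "- a" p r] fb \<epsilon> by (auto simp: flat_cyl_minus)
  have r: "0 < r" using fb by (simp add: flat_cyl_def)
  have eq: "hi z = - lo z" if z: "a \<bullet> z = 0" "2 * norm z < r" for z
  proof (rule ccontr)
    assume "hi z \<noteq> - lo z"
    then obtain q where "q \<in> X" "ennreal (split_density (CARD('n) - 1) \<epsilon>) \<le> tangent_multiplicity X q"
      using split_sheets_density[OF tf \<epsilon>(1,2) a hi lo z] by blast
    then show False using mult[of q] \<epsilon>(3) by (meson leD order_trans)
  qed
  define U where "U = X \<inter> ({x. norm (perp a (x - p)) < r / 2} \<inter> {x. \<bar>a \<bullet> (x - p)\<bar> < r})"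
  have op: "openin (top_of_set X) U" unfolding U_def
    by (intro openin_open_Int open_Int open_Collect_less continuous_intros)
  have pU: "p \<in> U" using p r by (simp add: U_def perp_simps)
  have "U = sheet p a hi ` open_disc a (r / 2)"
  proof (intro equalityI subsetI)
    fix x assume x: "x \<in> U"
    define z where "z = perp a (x - p)"
    define t where "t = a \<bullet> (x - p)"
    have az: "a \<bullet> z = 0" by (simp add: z_def perp_unit[OF a])
    have nz: "norm z < r / 2" using x by (simp add: U_def z_def)
    have xt: "x = p + z + t *\<^sub>R a" using perp_decomp[of "x - p" a] by (simp add: z_def t_def algebra_simps)
    have xb: "p + z + t *\<^sub>R a \<in> cyl a p r" using x unfolding xt[symmetric] by (auto simp: U_def cyl_def)
    have zD: "z \<in> open_disc a r" using az nz r by (simp add: open_disc_def)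
    have "t \<le> hi z" using hi zD xb unfolding is_top_sheet_def by blast
    moreover have "- t \<le> lo z"
    proof -
      have "p + z + (- t) *\<^sub>R (- a) \<in> cyl (- a) p r" using xb by (simp add: cyl_minus)
      then show ?thesis using lo zD unfolding is_top_sheet_def open_disc_minus by blast
    qed
    ultimately have "t = hi z" using eq[OF az] nz by simp
    then have "x = sheet p a hi z" using xt by (simp add: sheet_def)
    then show "x \<in> sheet p a hi ` open_disc a (r / 2)" using az nz by (simp add: open_disc_def)
  next
    fix x assume "x \<in> sheet p a hi ` open_disc a (r / 2)"
    then obtain z where z: "a \<bullet> z = 0" "norm z < r / 2" "x = sheet p a hi z" by (auto simp: open_disc_def)
    then have zD: "z \<in> open_disc a r" using r by (simp add: open_disc_def)
    have "\<bar>hi z\<bar> \<le> \<epsilon> * norm z" "x \<in> X"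
      using hi zD z(3) unfolding is_top_sheet_def by (auto simp: sheet_def cyl_def)
    moreover have "\<epsilon> * norm z \<le> norm z" using \<epsilon> by (simp add: mult_left_le_one_le)
    ultimately show "x \<in> U" using z perp_sheet[OF a z(1), of p hi] r by (simp add: U_def)
  qed
  moreover have "continuous_on (open_disc a (r / 2)) hi"
  proof (rule continuous_on_subset)
    show "continuous_on (open_disc a r) hi" using hi unfolding is_top_sheet_def by blast
  qed (use r in \<open>auto simp: open_disc_def\<close>)
  ultimately have "U homeomorphic coord_hyperplane \<inter> ball (0 :: real ^ 'n) (r / 2)"
    using sheet_homeomorphic[OF a] by simp
  moreover have "openin (top_of_set coord_hyperplane) (coord_hyperplane \<inter> ball (0 :: real ^ 'n) (r / 2))"
    by (simp add: openin_open_Int)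
  ultimately show "\<exists>U V. openin (top_of_set X) U \<and> p \<in> U \<and>
      openin (top_of_set (coord_hyperplane :: (real ^ 'n) set)) V \<and> U homeomorphic V"
    using op pU by blast
qed

theorem theorem1p1:
  fixes X :: "(real ^ 'n) set"
  assumes "loc_closed X"
    and "\<And>p. p \<in> X \<Longrightarrow> flat_tangent_cone X p"
    and "continuous_tangent_cones X"
  shows "(\<exists>\<F>. (\<forall>S\<in>\<F>. C1_hypersurface S) \<and> X = \<Union>\<F>) \<and>
    ((\<exists>m::ennreal. m < 3 / 2 \<and> (\<forall>p\<in>X. tangent_multiplicity X p \<le> m)) \<longrightarrow> hypersurface X)"
proof (intro conjI impI)
  obtain \<nu> where tf: "tangent_field X \<nu>" using tangent_field_exists[OF assms] by blast
  show "\<exists>\<F>. (\<forall>S\<in>\<F>. C1_hypersurface S) \<and> X = \<Union>\<F>"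
    using C1_hypersurface_through[OF tf]
    by (intro exI[of _ "{S. C1_hypersurface S \<and> S \<subseteq> X}"]) blast
  assume "\<exists>m::ennreal. m < 3 / 2 \<and> (\<forall>p\<in>X. tangent_multiplicity X p \<le> m)"
  then show "hypersurface X" using hypersurface_of_low_multiplicity[OF tf] by blast
qed

end
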